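(* Let $(p^k)_{k\ge 0}$ be the sequence of traffic profiles generated by the Off-DS algorithm started from a feasible profile $p^0$. Then, almost surely, $p^k$ converges as $k\to\infty$ to an equilibrium traffic profile $p^\infty$ (possibly random).
   Context: Time slots: $\mathcal T=\{1,\dots,T\}$. Vectors in $\mathbb R^T$ are written $x=\{x(t)\}_{t\in\mathcal T}$, with Euclidean inner product and norm. There is a known base traffic profile $b\in\mathbb R^T$ and a set $\mathcal N=\{1,\dots,N\}$, $N\ge2$, of deferrable applications (DAs), partitioned into continuous DAs $\mathcal N'$ and discrete DAs $\mathcal N''$. Feasible profiles. For $n\in\mathcal N'$, a profile $p_n\in\mathbb R^T$ is feasible if $\underline p_n(t)\le p_n(t)\le\overline p_n(t)$ for all $t\in\mathcal T$ and $\sum_{t\in\mathcal T}p_n(t)=P_n$, where $0\le\underline p_n(t)\le\overline p_n(t)$ and $P_n$ are given and the feasible set is nonempty. For $n\in\mathcal N''$, there are a given rate $r_n>0$, arrival time $t_n^a$, deadline $t_n^d$, and number $l_n\geq 1$ of consecutive timeslots (total traffic $P_n=l_nr_n$); the feasible set is the finite nonempty set $\mathcal F_n=\{f_{n,a}:1\le a\le A_n\}$ with $A_n=t_n^d-t_n^a-l_n+1$, where $f_{n,a}(t)=r_n$ if $t_n^a+a-1\le t\le t_n^a+a+l_n-2$ and $f_{n,a}(t)=0$ otherwise. A profile $p=\{p_n\}_{n\in\mathcal N}$ is feasible if each $p_n$ is. Off-DS algorithm. Start from a feasible $p^0$. At iteration $k$, set $d^k=\frac1N(b+\sum_{n\in\mathcal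 N}p_n^k)$. Each $n\in\mathcal N'$ sets $p_n^{k+1}$ to be the minimizer of $\|p_n-p_n^k+d^k\|_2^2$ over its feasible profiles. Each $n\in\mathcal N''$ computes the minimizer $p_n^{*\,k+1}$ of $\big\|p_n-\frac{N}{N-1}(p_n^k-d^k)\big\|_2^2$ over $p_n\in\mathrm{conv}(\mathcal F_n)$, writes it as a convex combination $p_n^{*\,k+1}=\sum_{a=1}^{A_n}u_{n,a}^{k+1}f_{n,a}$, and randomly sets $p_n^{k+1}=f_{n,a}$ with probability $u_{n,a}^{k+1}$. Given $p^k$, the random choices of different DAs are independent. Equilibrium. A feasible profile $p^\infty$ is an equilibrium traffic profile of the Off-DS algorithm if $p^k=p^\infty$ implies $p^{k+1}=p^\infty$ (with probability one). *)

theory Defs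
  imports "HOL-Probability.Probability"
begin

text \<open>
  Time slots are the elements of a finite linearly ordered type \<open>'t\<close>, so \<open>T = CARD('t)\<close>; the slot
  number \<open>slot t\<close> identifies \<open>'t\<close> with \<open>{1..T}\<close> in increasing order.  Applications are the elements
  of a finite type \<open>'n\<close>, so \<open>N = CARD('n)\<close>.
\<close>

definition slot :: "'t :: {finite, linorder} \<Rightarrow> nat" where
  "slot t = card {..t}"

type_synonym 't traffic = "real ^ 't"

type_synonym ('t, 'n) profile = "real ^ 't ^ 'n"

text \<open>
  The fields \<open>lower\<close>, \<open>upper\<close>, \<open>total\<close> only matter for continuous applications, the fields \<open>rate\<close>,
  \<open>arrival\<close>, \<open>deadline\<close>, \<open>duration\<close> only for discrete ones.
\<close>

record ('t, 'n) da_problem =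
  base     :: "real ^ ('t :: finite)"
  cont_das :: "'n set"
  lower    :: "'n \<Rightarrow> real ^ 't"
  upper    :: "'n \<Rightarrow> real ^ 't"
  total    :: "'n \<Rightarrow> real"
  rate     :: "'n \<Rightarrow> real"
  arrival  :: "'n \<Rightarrow> nat"
  deadline :: "'n \<Rightarrow> nat"
  duration :: "'n \<Rightarrow> nat"

abbreviation disc_das :: "('t :: finite, 'n) da_problem \<Rightarrow> 'n set" where
  "disc_das S \<equiv> - cont_das S"

text \<open>
  \<open>shifts S n\<close> is \<open>max 0 (deadline - arrival - duration + 1)\<close>; the order of the operations matters
  because subtraction on \<^typ>\<open>nat\<close> truncates.
\<close>

definition shifts :: "('t :: finite, 'n) da_problem \<Rightarrow> 'n \<Rightarrow> nat" where
  "shifts S n = deadline S n + 1 - (arrival S n + duration S n)"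

definition block :: "('t :: {finite, linorder}, 'n) da_problem \<Rightarrow> 'n \<Rightarrow> nat \<Rightarrow> 't traffic" where
  "block S n a =
     (\<chi> t. if arrival S n + a - 1 \<le> slot t \<and> slot t \<le> arrival S n + a + duration S n - 2
          then rate S n else 0)"

definition blocks :: "('t :: {finite, linorder}, 'n) da_problem \<Rightarrow> 'n \<Rightarrow> 't traffic set" where
  "blocks S n = block S n ` {1..shifts S n}"

definition feasible_set :: "('t :: {finite, linorder}, 'n) da_problem \<Rightarrow> 'n \<Rightarrow> 't traffic set" where
  "feasible_set S n =
     (if n \<in> cont_das S
      then {x. (\<forall>t. lower S n $ t \<le> x $ t \<and> x $ t \<le> upper S n $ t) \<and> (\<Sum>t\<in>UNIV. x $ t) = total S n}
      else blocks S n)"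

definition feasible :: "('t :: {finite, linorder}, 'n :: finite) da_problem \<Rightarrow> ('t, 'n) profile \<Rightarrow> bool" where
  "feasible S p \<longleftrightarrow> (\<forall>n. p $ n \<in> feasible_set S n)"

text \<open>
  The last block of a discrete application ends in slot \<open>deadline - 1\<close>.  The bounds on \<open>arrival\<close> and
  \<open>deadline\<close> therefore say that every block lies within the horizon, i.e. that each of them carries
  the total traffic \<open>duration * rate\<close>.
\<close>

definition valid_problem :: "('t :: {finite, linorder}, 'n) da_problem \<Rightarrow> bool" where
  "valid_problem S \<longleftrightarrow>
     (\<forall>n\<in>cont_das S. (\<forall>t. 0 \<le> lower S n $ t \<and> lower S n $ t \<le> upper S n $ t)
                  \<and> feasible_set S n \<noteq> {}) \<and>
     (\<forall>n\<in>disc_das S. rate S n > 0 \<and> duration S n \<ge> 1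
                  \<and> arrival S n \<ge> 1 \<and> deadline S n \<le> CARD('t) + 1
                  \<and> feasible_set S n \<noteq> {})"

definition average_profile :: "('t :: finite, 'n :: finite) da_problem \<Rightarrow> ('t, 'n) profile \<Rightarrow> 't traffic" where
  "average_profile S p = (1 / real CARD('n)) *\<^sub>R (base S + (\<Sum>n\<in>UNIV. p $ n))"

definition cont_update ::
    "('t :: {finite, linorder}, 'n :: finite) da_problem \<Rightarrow> ('t, 'n) profile \<Rightarrow> 'n \<Rightarrow> 't traffic" where
  "cont_update S p n =
     arg_min_on (\<lambda>x. (norm (x - p $ n + average_profile S p))\<^sup>2) (feasible_set S n)"

definition disc_relaxed ::
    "('t :: {finite, linorder}, 'n :: finite) da_problem \<Rightarrow> ('t, 'n) profile \<Rightarrow> 'n \<Rightarrow> 't traffic" where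
  "disc_relaxed S p n =
     arg_min_on
       (\<lambda>x. (norm (x - (real CARD('n) / (real CARD('n) - 1)) *\<^sub>R (p $ n - average_profile S p)))\<^sup>2)
       (convex hull (blocks S n))"

text \<open>
  The weights of the convex combination, packaged as a distribution on the shifts.  In a valid problem
  the blocks of a discrete application are linearly independent (their first slots are distinct), so
  the weights are unique.
\<close>

definition shift_weights ::
    "('t :: {finite, linorder}, 'n :: finite) da_problem \<Rightarrow> ('t, 'n) profile \<Rightarrow> 'n \<Rightarrow> nat pmf" where
  "shift_weights S p n =
     (SOME u. set_pmf u \<subseteq> {1..shifts S n} \<and>
              disc_relaxed S p n = (\<Sum>a = 1..shifts S n. pmf u a *\<^sub>R block S n a))"

text \<open>The law of the next profile, given that the current one is \<open>p\<close>.\<close>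

definition step ::
    "('t :: {finite, linorder}, 'n :: finite) da_problem \<Rightarrow> ('t, 'n) profile \<Rightarrow> (('t, 'n) profile) pmf" where
  "step S p =
     map_pmf (\<lambda>a. \<chi> n. if n \<in> cont_das S then cont_update S p n else block S n (a n))
       (Pi_pmf (disc_das S) undefined (shift_weights S p))"

text \<open>
  Every \<open>X k\<close> takes only finitely many values almost surely, so the conditional law of \<open>X (Suc k)\<close>
  given the past is determined by elementary conditioning on the histories of positive probability.
\<close>

definition off_ds_process ::
    "('t :: {finite, linorder}, 'n :: finite) da_problem \<Rightarrow> ('t, 'n) profile \<Rightarrow>
     'w measure \<Rightarrow> (nat \<Rightarrow> 'w \<Rightarrow> ('t, 'n) profile) \<Rightarrow> bool" where
  "off_ds_process S p0 M X \<longleftrightarrow>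
     prob_space M \<and>
     (\<forall>k. X k \<in> borel_measurable M) \<and>
     (AE \<omega> in M. X 0 \<omega> = p0) \<and>
     (\<forall>k x y. \<P>(\<omega> in M. \<forall>i\<le>k. X i \<omega> = x i) > 0 \<longrightarrow>
        \<P>(\<omega> in M. X (Suc k) \<omega> = y \<bar> \<forall>i\<le>k. X i \<omega> = x i) = pmf (step S (x k)) y)"

definition equilibrium :: "('t :: {finite, linorder}, 'n :: finite) da_problem \<Rightarrow> ('t, 'n) profile \<Rightarrow> bool" where
  "equilibrium S q \<longleftrightarrow> feasible S q \<and> (AE p' in measure_pmf (step S q). p' = q)"

end

theory Submission
  imports Defs
begin

text \<open>
  The energy is the squared norm of the total load \<open>D = b + \<Sum>p\<^sub>n\<close>.  Let \<open>\<delta>(p)\<close> be the expected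
  displacement of \<open>p\<close> in one iteration.  Because all blocks of an application have the same norm,
  the energy decreases in expectation by at least \<open>(N - 1) \<parallel>\<delta>\<parallel>\<^sup>2\<close>.  This only makes \<open>\<delta>\<close>
  square-summable, whereas the probability of a change of blocks is of the order of \<open>\<parallel>\<delta>\<parallel>\<close>.

  To gain summability of \<open>\<parallel>\<delta>\<parallel>\<close> itself, let the level of \<open>p\<close> be the minimal energy that can be
  reached without changing the discrete profiles.  A Hoffman error bound shows that the excess \<open>e\<close>
  of the energy over the level contracts by a fixed factor as long as the blocks do not change, and
  \<open>\<parallel>\<delta>\<parallel> = O(\<surd>e)\<close> where \<open>\<delta>\<close> is small.  There are finitely many levels, and to first order a single
  change of block leaves the energy unchanged.  Hence for suitable \<open>A\<close> and \<open>\<beta>\<close> the function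
  \<open>A \<cdot> energy + \<beta> \<cdot> level + \<surd>e\<close> decreases in expectation by a multiple of \<open>\<parallel>\<delta>\<parallel>\<close>.  So almost surely
  the displacements are summable, and \<open>\<delta>\<close> vanishes at the limit.
\<close>

section \<open>Error bounds and projections\<close>


text \<open>Effects of different orders compete. All blocks of an application have one norm, so the
  squared distance to the current block is linear in the new block; its mean, and with it the
  probability of a change, is therefore of first order in \<parallel>\<delta>\<parallel>. Since a
  change can destroy a tiny excess, contraction of e alone proves nothing. The accounting for small
  \<parallel>\<delta>\<parallel> is as follows. Without a change, sqrt e loses a fixed fraction,
  worth a multiple of \<parallel>\<delta>\<parallel>. A single change within a level leaves an
  excess O(\<parallel>\<delta>\<parallel>), so its expected cost is
  O(\<parallel>\<delta>\<parallel>) times O(sqrt \<parallel>\<delta>\<parallel>), of order 3/2. Two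
  changes at once cost order 2, by independence. A fall to a lower level can enlarge e arbitrarily
  within its range; \<beta> is chosen so that the smallest gap between levels pays for this. When
  \<parallel>\<delta>\<parallel> is bounded below, the quadratic decrease of the energy, weighted by
  A, outweighs everything else.\<close>

lemma sign_cone_bound:
  fixes L :: "'a::euclidean_space \<Rightarrow> 'b::real_normed_vector"
  assumes L: "bounded_linear L"
    and inj: "\<And>u. \<forall>i\<in>Basis. (i \<notin> P \<longrightarrow> u \<bullet> i \<le> 0) \<and> (i \<notin> Q \<longrightarrow> 0 \<le> u \<bullet> i) \<Longrightarrow> L u = 0 \<Longrightarrow> u = 0"
  shows "\<exists>c\<ge>0. \<forall>u. (\<forall>i\<in>Basis. (i \<notin> P \<longrightarrow> u \<bullet> i \<le> 0) \<and> (i \<notin> Q \<longrightarrow> 0 \<le> u \<bullet> i)) \<longrightarrow>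
           norm u \<le> c * norm (L u)"
proof -
  interpret L: bounded_linear L by fact
  \<comment> \<open>\<open>P\<close> and \<open>Q\<close> hold the coordinates that may be positive
    and negative respectively; a coordinate in neither is forced to be 0. On the compact set of unit
    vectors of this closed cone, \<open>norm (L u)\<close> attains a minimum, positive by
    \<open>inj\<close>, and homogeneity extends the bound. If there are no such unit vectors, the
    cone is trivial.\<close>
  define K where "K = {u. \<forall>i\<in>Basis. (i \<notin> P \<longrightarrow> u \<bullet> i \<le> 0) \<and> (i \<notin> Q \<longrightarrow> 0 \<le> u \<bullet> i)}"
  have "K = (\<Inter>i\<in>Basis. {u. i \<notin> P \<longrightarrow> u \<bullet> i \<le> 0} \<inter> {u. i \<notin> Q \<longrightarrow> 0 \<le> u \<bullet> i})"
    by (auto simp: K_def)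
  then have "closed K"
    by (auto intro!: closed_INT closed_Int closed_Collect_imp closed_Collect_le continuous_intros)
  then have comp: "compact (K \<inter> sphere 0 1)"
    by (simp add: closed_Int_compact)
  have cont: "continuous_on (K \<inter> sphere 0 1) (\<lambda>u. norm (L u))"
    by (intro continuous_intros L.continuous_on)
  show ?thesis
  proof (cases "K \<inter> sphere 0 1 = {}")
    case True
    have "u = 0" if "u \<in> K" for u
    proof (rule ccontr)
      assume "u \<noteq> 0"
      moreover from this have "u /\<^sub>R norm u \<in> K"
        using that by (auto simp: K_def mult_nonneg_nonpos)
      ultimately show False using True by (auto simp: norm_sgn[unfolded sgn_div_norm])
    qed
    then show ?thesis unfolding K_def by (intro exI[of _ 0]) auto
  next
    case False
    obtain u0 where u0: "u0 \<in> K" "norm u0 = 1"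
      and min: "\<And>u. u \<in> K \<Longrightarrow> norm u = 1 \<Longrightarrow> norm (L u0) \<le> norm (L u)"
      using continuous_attains_inf[OF comp False cont] by auto
    have pos: "norm (L u0) > 0" using inj[of u0] u0 by (auto simp: K_def)
    have "norm u \<le> 1 / norm (L u0) * norm (L u)" if "u \<in> K" for u
    proof (cases "u = 0")
      case False
      have "u /\<^sub>R norm u \<in> K"
        using that by (auto simp: K_def mult_nonneg_nonpos)
      then have "norm (L u0) \<le> norm (L (u /\<^sub>R norm u))"
        using False by (intro min) auto
      also have "\<dots> = norm (L u) / norm u"
        by (simp add: L.scaleR field_simps)
      finally show ?thesis using False pos by (simp add: field_simps)
    qed simp
    then show ?thesis unfolding K_def by (intro exI[of _ "1 / norm (L u0)"]) auto
  qed
qed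

text \<open>
  A Hoffman-type error bound.  In an \<open>\<ell>\<^sup>1\<close>-minimal solution \<open>w\<close> no nonzero element of the kernel
  follows the signs of \<open>w\<close>, since a small multiple of it could be subtracted; hence \<open>L\<close> is bounded
  below on the cone given by these signs, and there are only finitely many such cones.
\<close>

lemma conformal_error_bound:
  fixes L :: "'a::euclidean_space \<Rightarrow> 'b::real_normed_vector"
  assumes L: "bounded_linear L"
  obtains C where "C \<ge> 0"
    "\<And>z. \<exists>w. (\<forall>i\<in>Basis. min 0 (z \<bullet> i) \<le> w \<bullet> i \<and> w \<bullet> i \<le> max 0 (z \<bullet> i)) \<and> L w = L z \<and>
         norm w \<le> C * norm (L z)"
proof -
  interpret L: bounded_linear L by fact
  define cone where "cone = (\<lambda>(P, Q). {u::'a. \<forall>i\<in>Basis. (i \<notin> P \<longrightarrow> u \<bullet> i \<le> 0) \<and> (i \<notin> Q \<longrightarrow> 0 \<le> u \<bullet> i)})"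
  define I where "I = {PQ \<in> Pow Basis \<times> Pow (Basis::'a set). \<forall>u\<in>cone PQ. L u = 0 \<longrightarrow> u = 0}"
  have "finite I" by (simp add: I_def)
  have "\<forall>PQ\<in>I. \<exists>c\<ge>0. \<forall>u\<in>cone PQ. norm u \<le> c * norm (L u)"
  proof
    fix PQ assume "PQ \<in> I"
    obtain P Q where PQ: "PQ = (P, Q)" by fastforce
    show "\<exists>c\<ge>0. \<forall>u\<in>cone PQ. norm u \<le> c * norm (L u)"
      using sign_cone_bound[OF L, of P Q] \<open>PQ \<in> I\<close> by (auto simp: PQ I_def cone_def)
  qed
  then obtain c where c: "\<And>PQ. PQ \<in> I \<Longrightarrow> c PQ \<ge> 0"
    "\<And>PQ u. PQ \<in> I \<Longrightarrow> u \<in> cone PQ \<Longrightarrow> norm u \<le> c PQ * norm (L u)"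
    by metis
  \<comment> \<open>Summing over all admissible sign patterns makes the constant independent of
    \<open>z\<close>.\<close>
  define C where "C = sum c I"
  have "C \<ge> 0" using c by (auto simp: C_def intro: sum_nonneg)
  moreover have "\<exists>w. (\<forall>i\<in>Basis. min 0 (z \<bullet> i) \<le> w \<bullet> i \<and> w \<bullet> i \<le> max 0 (z \<bullet> i)) \<and> L w = L z \<and>
         norm w \<le> C * norm (L z)" for z
  proof -
    define K where "K = cbox (\<Sum>i\<in>Basis. min 0 (z \<bullet> i) *\<^sub>R i) (\<Sum>i\<in>Basis. max 0 (z \<bullet> i) *\<^sub>R i) \<inter> {w. L w = L z}"
    have K: "w \<in> K \<longleftrightarrow> (\<forall>i\<in>Basis. min 0 (z \<bullet> i) \<le> w \<bullet> i \<and> w \<bullet> i \<le> max 0 (z \<bullet> i)) \<and> L w = L z" for w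
      by (simp add: K_def mem_box)
    have "compact K"
      unfolding K_def
      by (intro compact_Int_closed compact_cbox closed_Collect_eq L.continuous_on continuous_intros)
    moreover have "z \<in> K" by (auto simp: K)
    moreover have "continuous_on K (\<lambda>w. \<Sum>i\<in>Basis. \<bar>w \<bullet> i\<bar>)"
      by (intro continuous_intros)
    ultimately obtain w where w: "w \<in> K"
      and min: "\<And>w'. w' \<in> K \<Longrightarrow> (\<Sum>i\<in>Basis. \<bar>w \<bullet> i\<bar>) \<le> (\<Sum>i\<in>Basis. \<bar>w' \<bullet> i\<bar>)"
      using continuous_attains_inf[of K] by blast
    \<comment> \<open>The sign pattern of \<open>w\<close> itself: a vector of this cone vanishes
      wherever \<open>w\<close> does and never opposes a sign of \<open>w\<close>.\<close>
    define PQ where "PQ = ({i\<in>Basis. w \<bullet> i > 0}, {i\<in>Basis. w \<bullet> i < 0})"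
    have "u = 0" if u: "u \<in> cone PQ" and Lu: "L u = 0" for u
    proof (rule ccontr)
      assume "u \<noteq> 0"
      \<comment> \<open>Small enough that \<open>t * \<bar>u \<bullet> i\<bar> \<le> \<bar>w
        \<bullet> i\<bar>\<close> in every coordinate. The added 1 keeps the denominator positive;
        where \<open>w \<bullet> i = 0\<close>, also \<open>u \<bullet> i = 0\<close>.\<close>
      define t where "t = 1 / ((\<Sum>i\<in>Basis. \<bar>u \<bullet> i\<bar> / \<bar>w \<bullet> i\<bar>) + 1)"
      have S: "(\<Sum>i\<in>Basis. \<bar>u \<bullet> i\<bar> / \<bar>w \<bullet> i\<bar>) \<ge> 0" by (intro sum_nonneg) auto
      then have t: "t > 0" by (simp add: t_def)
      have sgn: "\<not> (w \<bullet> i > 0 \<and> u \<bullet> i < 0)" "\<not> (w \<bullet> i < 0 \<and> u \<bullet> i > 0)" "w \<bullet> i = 0 \<longrightarrow> u \<bullet> i = 0"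
        if "i \<in> Basis" for i
        using u that by (force simp: cone_def PQ_def)+
      have small: "t * \<bar>u \<bullet> i\<bar> \<le> \<bar>w \<bullet> i\<bar>" if "i \<in> Basis" for i
      proof (cases "w \<bullet> i = 0")
        case False
        have "\<bar>u \<bullet> i\<bar> / \<bar>w \<bullet> i\<bar> \<le> (\<Sum>i\<in>Basis. \<bar>u \<bullet> i\<bar> / \<bar>w \<bullet> i\<bar>)"
          using that by (intro member_le_sum) auto
        then have "\<bar>u \<bullet> i\<bar> / \<bar>w \<bullet> i\<bar> \<le> 1 / t" by (simp add: t_def)
        then show ?thesis using False t by (simp add: field_simps)
      qed (use sgn[OF that] in auto)
      have abs: "\<bar>(w - t *\<^sub>R u) \<bullet> i\<bar> = \<bar>w \<bullet> i\<bar> - t * \<bar>u \<bullet> i\<bar>"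
        and bds: "min 0 (w \<bullet> i) \<le> (w - t *\<^sub>R u) \<bullet> i" "(w - t *\<^sub>R u) \<bullet> i \<le> max 0 (w \<bullet> i)" if i: "i \<in> Basis" for i
      proof -
        consider "w \<bullet> i > 0" "u \<bullet> i \<ge> 0" | "w \<bullet> i < 0" "u \<bullet> i \<le> 0" | "w \<bullet> i = 0" "u \<bullet> i = 0"
          using sgn[OF i] by force
        then have "\<bar>(w - t *\<^sub>R u) \<bullet> i\<bar> = \<bar>w \<bullet> i\<bar> - t * \<bar>u \<bullet> i\<bar> \<and>
            min 0 (w \<bullet> i) \<le> (w - t *\<^sub>R u) \<bullet> i \<and> (w - t *\<^sub>R u) \<bullet> i \<le> max 0 (w \<bullet> i)"
        proof cases
          case 1
          moreover have "t * (u \<bullet> i) \<ge> 0" using 1 t by simp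
          ultimately show ?thesis using small[OF i] by (simp add: inner_diff_left)
        next
          case 2
          moreover have "t * (u \<bullet> i) \<le> 0" using 2 t by (simp add: mult_nonneg_nonpos)
          ultimately show ?thesis using small[OF i] by (simp add: inner_diff_left)
        next
          case 3
          then show ?thesis by (simp add: inner_diff_left)
        qed
        then show "\<bar>(w - t *\<^sub>R u) \<bullet> i\<bar> = \<bar>w \<bullet> i\<bar> - t * \<bar>u \<bullet> i\<bar>"
          "min 0 (w \<bullet> i) \<le> (w - t *\<^sub>R u) \<bullet> i" "(w - t *\<^sub>R u) \<bullet> i \<le> max 0 (w \<bullet> i)" by auto
      qed
      have "w - t *\<^sub>R u \<in> K"
        unfolding K
      proof (intro conjI ballI)
        fix i :: 'a assume i: "i \<in> Basis"
        show "min 0 (z \<bullet> i) \<le> (w - t *\<^sub>R u) \<bullet> i"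
          using bds(1)[OF i] w[unfolded K] i by force
        show "(w - t *\<^sub>R u) \<bullet> i \<le> max 0 (z \<bullet> i)"
          using bds(2)[OF i] w[unfolded K] i by force
      qed (use w Lu in \<open>auto simp: K L.diff L.scaleR\<close>)
      from min[OF this] have "t * (\<Sum>i\<in>Basis. \<bar>u \<bullet> i\<bar>) \<le> 0"
        by (simp add: abs sum_subtractf sum_distrib_left)
      then have "(\<Sum>i\<in>Basis. \<bar>u \<bullet> i\<bar>) \<le> 0" using t by (simp add: mult_le_0_iff)
      then have "(\<Sum>i\<in>Basis. \<bar>u \<bullet> i\<bar>) = 0" by (intro antisym sum_nonneg) auto
      then have "\<forall>i\<in>Basis. u \<bullet> i = 0" by (simp add: sum_nonneg_eq_0_iff)
      then show False using \<open>u \<noteq> 0\<close> euclidean_all_zero_iff by blast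
    qed
    then have "PQ \<in> I" by (auto simp: I_def PQ_def)
    moreover have "w \<in> cone PQ" by (auto simp: cone_def PQ_def)
    ultimately have "norm w \<le> c PQ * norm (L w)" by (rule c)
    also have "\<dots> \<le> C * norm (L w)"
      unfolding C_def using c \<open>finite I\<close> \<open>PQ \<in> I\<close>
      by (intro mult_right_mono member_le_sum) auto
    finally show ?thesis using w by (auto simp: K)
  qed
  ultimately show thesis by (rule that)
qed

section \<open>Projections onto convex sets and convex hulls of finite families\<close>

lemma arg_min_on_norm_eq_closest_point:
  fixes K :: "'a::euclidean_space set"
  assumes "closed K" "convex K" "K \<noteq> {}"
  shows "arg_min_on (\<lambda>x. (norm (x - z))\<^sup>2) K = closest_point K z"
proof -
  have ex: "is_arg_min (\<lambda>x. (norm (x - z))\<^sup>2) (\<lambda>x. x \<in> K) (closest_point K z)"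
    using closest_point_exists[OF assms(1,3), of z]
    by (auto simp: is_arg_min_linorder dist_norm norm_minus_commute intro!: power_mono)
  \<comment> \<open>\<open>arg_min_on\<close> is a choice operator, so its value is identified only
    once the minimiser is known to be unique.\<close>
  have uniq: "x = closest_point K z" if "is_arg_min (\<lambda>x. (norm (x - z))\<^sup>2) (\<lambda>x. x \<in> K) x" for x
    using that assms
    by (intro closest_point_unique) (auto simp: is_arg_min_linorder dist_norm norm_minus_commute)
  show ?thesis
    unfolding arg_min_on_def arg_min_def using ex uniq by (metis (mono_tags, lifting) someI_ex)
qed

lemma closest_point_inner_le:
  fixes K :: "'a::euclidean_space set"
  assumes "closed K" "convex K" "y \<in> K"
  shows "0 \<le> (closest_point K z - z) \<bullet> (y - closest_point K z)"
  using closest_point_dot[OF assms(2,1,3), of z] by (simp add: inner_diff_left)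

text \<open>A Bernoulli mixture of two distributions realises the convex combination of their
  averages, and point masses give the generators. The distribution lives on indices, so repeated
  values of \<open>f\<close> do no harm. This supplies the witness for the choice in
  \<open>shift_weights\<close>.\<close>

lemma convex_hull_image_pmf:
  fixes f :: "'i \<Rightarrow> 'a::real_vector"
  assumes "finite I" "x \<in> convex hull (f ` I)"
  shows "\<exists>u. set_pmf u \<subseteq> I \<and> x = (\<Sum>i\<in>I. pmf u i *\<^sub>R f i)"
proof -
  define T where "T = {x. \<exists>u. set_pmf u \<subseteq> I \<and> x = (\<Sum>i\<in>I. pmf u i *\<^sub>R f i)}"
  have "convex T"
  proof (rule convexI)
    fix x y and a b :: real
    assume "x \<in> T" "y \<in> T" and ab: "0 \<le> a" "0 \<le> b" "a + b = 1"
    then obtain u v where u: "set_pmf u \<subseteq> I" "x = (\<Sum>i\<in>I. pmf u i *\<^sub>R f i)"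
      and v: "set_pmf v \<subseteq> I" "y = (\<Sum>i\<in>I. pmf v i *\<^sub>R f i)" by (auto simp: T_def)
    define w where "w = bind_pmf (bernoulli_pmf a) (\<lambda>c. if c then u else v)"
    have "b = 1 - a" using ab by simp
    then have "pmf w i = a * pmf u i + b * pmf v i" for i
      using ab by (simp add: w_def pmf_bind)
    then have "a *\<^sub>R x + b *\<^sub>R y = (\<Sum>i\<in>I. pmf w i *\<^sub>R f i)"
      by (simp add: u v scaleR_sum_right sum.distrib algebra_simps)
    moreover have "set_pmf w \<subseteq> I" using u v by (auto simp: w_def split: if_splits)
    ultimately show "a *\<^sub>R x + b *\<^sub>R y \<in> T" unfolding T_def by blast
  qed
  moreover have "f i \<in> T" if "i \<in> I" for i
  proof -
    have "(\<Sum>j\<in>I. pmf (return_pmf i) j *\<^sub>R f j) = (\<Sum>j\<in>{i}. pmf (return_pmf i) j *\<^sub>R f j)"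
      using assms(1) that by (intro sum.mono_neutral_right) (auto simp: pmf_return)
    then show ?thesis unfolding T_def using that by (auto intro!: exI[of _ "return_pmf i"])
  qed
  ultimately have "convex hull (f ` I) \<subseteq> T" by (intro hull_minimal) auto
  then show ?thesis using assms(2) by (auto simp: T_def)
qed

text \<open>Source of all uniform gaps: between distinct blocks, between levels, and for nonzero
  drifts at optima. The element 1 inserted below covers the case of no positive element.\<close>

lemma finite_pos_lower_bound:
  fixes A :: "real set"
  assumes "finite A"
  obtains c where "c > 0" "\<And>x. x \<in> A \<Longrightarrow> 0 < x \<Longrightarrow> c \<le> x"
proof
  show "Min (insert 1 {x\<in>A. 0 < x}) > 0" using assms by (subst Min_gr_iff) auto
qed (use assms in auto)

lemma norm_sum_squared_le:
  fixes f :: "'i \<Rightarrow> 'a::real_normed_vector"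
  shows "(norm (\<Sum>i\<in>I. f i))\<^sup>2 \<le> real (card I) * (\<Sum>i\<in>I. (norm (f i))\<^sup>2)"
proof -
  have "(norm (\<Sum>i\<in>I. f i))\<^sup>2 \<le> (\<Sum>i\<in>I. norm (f i))\<^sup>2"
    by (intro power_mono norm_sum) auto
  also have "\<dots> \<le> real (card I) * (\<Sum>i\<in>I. (norm (f i))\<^sup>2)"
    using Cauchy_Schwarz_ineq_sum[of "\<lambda>_. 1" "\<lambda>i. norm (f i)" I] by simp
  finally show ?thesis .
qed

section \<open>Expectations under product distributions\<close>

lemma expectation_Pi_pmf_component:
  fixes f :: "'b \<Rightarrow> 'c::{banach,second_countable_topology}"
  assumes "finite A" "i \<in> A"
  shows "measure_pmf.expectation (Pi_pmf A d p) (\<lambda>x. f (x i)) = measure_pmf.expectation (p i) f"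
  using arg_cong[OF Pi_pmf_component[OF assms(1), of i d p], of "\<lambda>q. measure_pmf.expectation q f"] assms(2)
  by simp

text \<open>Independence yields the product formula over all coordinates in \<open>A\<close>; the
  factors away from \<open>i\<close> and \<open>j\<close> are taken to be the constant 1.\<close>

lemma expectation_Pi_pmf_mult:
  fixes f :: "'b \<Rightarrow> real" and g :: "'b \<Rightarrow> real"
  assumes "finite A" "i \<in> A" "j \<in> A" "i \<noteq> j" and fin: "\<And>i. i \<in> A \<Longrightarrow> finite (set_pmf (p i))"
  shows "measure_pmf.expectation (Pi_pmf A d p) (\<lambda>x. f (x i) * g (x j)) =
    measure_pmf.expectation (p i) f * measure_pmf.expectation (p j) g"
proof -
  define h where "h k = (if k = i then f else if k = j then g else (\<lambda>_. 1))" for k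
  have prod: "(\<Prod>k\<in>A. F (h k) k) = F f i * F g j" if "\<And>k. F (\<lambda>_. 1) k = 1" for F :: "_ \<Rightarrow> _ \<Rightarrow> real"
  proof -
    have "(\<Prod>k\<in>A. F (h k) k) = (\<Prod>k\<in>{i, j}. F (h k) k)"
      using assms that by (intro prod.mono_neutral_right) (auto simp: h_def)
    also have "\<dots> = F f i * F g j" using assms(4) by (simp add: h_def)
    finally show ?thesis .
  qed
  have "measure_pmf.expectation (Pi_pmf A d p) (\<lambda>x. \<Prod>k\<in>A. h k (x k)) =
    (\<Prod>k\<in>A. measure_pmf.expectation (Pi_pmf A d p) (\<lambda>x. h k (x k)))"
    using assms(1) fin
    by (intro prob_space.indep_vars_lebesgue_integral prob_space.indep_vars_compose2[OF _ indep_vars_Pi_pmf]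
        prob_space_measure_pmf integrable_measure_pmf_finite)
      (auto simp: set_Pi_pmf finite_PiE_dflt)
  also have "\<dots> = (\<Prod>k\<in>A. measure_pmf.expectation (p k) (h k))"
    by (intro prod.cong refl expectation_Pi_pmf_component assms)
  finally have "measure_pmf.expectation (Pi_pmf A d p) (\<lambda>x. \<Prod>k\<in>A. h k (x k)) =
    (\<Prod>k\<in>A. measure_pmf.expectation (p k) (h k))" .
  then show ?thesis
    using prod[of "\<lambda>h k. measure_pmf.expectation (p k) h"] prod[of "\<lambda>h k. h (x k)" for x]
    by (simp cong: if_cong)
qed

section \<open>Elementary Markov chains\<close>


lemma (in prob_space) prob_sum_values:
  assumes "finite F" "AE \<omega> in M. Y \<omega> \<in> F"
    and "\<And>h. h \<in> F \<Longrightarrow> {\<omega> \<in> space M. Y \<omega> = h} \<in> events" "{\<omega> \<in> space M. R \<omega>} \<in> events"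
  shows "\<P>(\<omega> in M. R \<omega>) = (\<Sum>h\<in>F. \<P>(\<omega> in M. Y \<omega> = h \<and> R \<omega>))"
  using assms
  by (intro prob_sum) auto

lemma (in prob_space) prob_in_finite:
  assumes "finite F" "\<And>y. y \<in> F \<Longrightarrow> {\<omega> \<in> space M. R \<omega> \<and> Y \<omega> = y} \<in> events"
  shows "\<P>(\<omega> in M. R \<omega> \<and> Y \<omega> \<in> F) = (\<Sum>y\<in>F. \<P>(\<omega> in M. R \<omega> \<and> Y \<omega> = y))"
proof -
  have "{\<omega> \<in> space M. R \<omega> \<and> Y \<omega> \<in> F} = (\<Union>y\<in>F. {\<omega> \<in> space M. R \<omega> \<and> Y \<omega> = y})" by auto
  then show ?thesis
    using assms by (simp only:) (intro finite_measure_finite_Union, auto simp: disjoint_family_on_def)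
qed

locale elementary_markov_chain = prob_space M for M :: "'w measure" +
  fixes X :: "nat \<Rightarrow> 'w \<Rightarrow> 'a::{second_countable_topology, t2_space}"
    and K :: "'a \<Rightarrow> 'a pmf" and x0 :: 'a
  assumes X_measurable [measurable]: "\<And>k. X k \<in> borel_measurable M"
    and start: "AE \<omega> in M. X 0 \<omega> = x0"
    and transition: "\<And>k x y. \<P>(\<omega> in M. \<forall>i\<le>k. X i \<omega> = x i) > 0 \<Longrightarrow>
        \<P>(\<omega> in M. X (Suc k) \<omega> = y \<bar> \<forall>i\<le>k. X i \<omega> = x i) = pmf (K (x k)) y"
    and finite_support: "\<And>x. finite (set_pmf (K x))"
begin

text \<open>Iterating the kernel gives the law of \<open>X k\<close> (see
  \<open>prob_marginal\<close>), so that expectations along the chain become finite sums.\<close>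

primrec marginal :: "nat \<Rightarrow> 'a pmf" where
  "marginal 0 = return_pmf x0"
| "marginal (Suc k) = bind_pmf (marginal k) K"

text \<open>Padding with \<open>x0\<close> beyond time \<open>k\<close> makes a history a total
  function, so that equality of functions means agreement up to time \<open>k\<close> and the set of
  histories stays finite.\<close>

definition history :: "nat \<Rightarrow> 'w \<Rightarrow> nat \<Rightarrow> 'a" where
  "history k \<omega> i = (if i \<le> k then X i \<omega> else x0)"

primrec histories :: "nat \<Rightarrow> (nat \<Rightarrow> 'a) set" where
  "histories 0 = {\<lambda>_. x0}"
| "histories (Suc k) = (\<Union>x\<in>histories k. (\<lambda>y. x(Suc k := y)) ` set_pmf (K (x k)))"

lemma finite_histories: "finite (histories k)"
  by (induction k) (auto simp: finite_support)

lemma histories_beyond: "x \<in> histories k \<Longrightarrow> i > k \<Longrightarrow> x i = x0"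
  by (induction k arbitrary: x) auto

lemma history_eq_iff: "x \<in> histories k \<Longrightarrow> history k \<omega> = x \<longleftrightarrow> (\<forall>i\<le>k. X i \<omega> = x i)"
  using histories_beyond[of x k] by (auto simp: history_def fun_eq_iff not_le)

text \<open>Multiplied out, the transition rule also covers histories of probability 0, where both
  sides vanish.\<close>

lemma prob_history_Suc:
  "\<P>(\<omega> in M. (\<forall>i\<le>k. X i \<omega> = x i) \<and> X (Suc k) \<omega> = y) =
   \<P>(\<omega> in M. \<forall>i\<le>k. X i \<omega> = x i) * pmf (K (x k)) y"
proof (cases "\<P>(\<omega> in M. \<forall>i\<le>k. X i \<omega> = x i) > 0")
  case True
  from transition[OF this, of y] True show ?thesis
    by (simp add: cond_prob_def field_simps conj_commute)
next
  case False
  then have "\<P>(\<omega> in M. \<forall>i\<le>k. X i \<omega> = x i) = 0"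
    using measure_nonneg[of M] by (meson linorder_not_le order.antisym)
  moreover have "\<P>(\<omega> in M. (\<forall>i\<le>k. X i \<omega> = x i) \<and> X (Suc k) \<omega> = y) \<le> \<P>(\<omega> in M. \<forall>i\<le>k. X i \<omega> = x i)"
    by (intro finite_measure_mono) auto
  ultimately show ?thesis using measure_nonneg[of M] by (simp add: order.antisym)
qed

text \<open>The probabilities of the finitely many successors of a history add up to the probability
  of that history, so every other continuation is null; finitely many histories give finitely many
  null sets.\<close>

lemma AE_history: "AE \<omega> in M. history k \<omega> \<in> histories k"
proof (induction k)
  case 0
  show ?case using start by eventually_elim (auto simp: history_def fun_eq_iff)
next
  case (Suc k)
  have "AE \<omega> in M. (\<forall>i\<le>k. X i \<omega> = x i) \<longrightarrow> X (Suc k) \<omega> \<in> set_pmf (K (x k))" if "x \<in> histories k" for x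
  proof -
    let ?A = "set_pmf (K (x k))" and ?W = "\<P>(\<omega> in M. \<forall>i\<le>k. X i \<omega> = x i)"
    let ?H = "{\<omega> \<in> space M. \<forall>i\<le>k. X i \<omega> = x i}"
      and ?G = "{\<omega> \<in> space M. (\<forall>i\<le>k. X i \<omega> = x i) \<and> X (Suc k) \<omega> \<in> ?A}"
    have "?A \<in> sets borel" by (intro borel_closed finite_imp_closed finite_support)
    then have sets: "?H \<in> events" "?G \<in> events" by measurable
    have "prob ?G = (\<Sum>y\<in>?A. \<P>(\<omega> in M. (\<forall>i\<le>k. X i \<omega> = x i) \<and> X (Suc k) \<omega> = y))"
      by (intro prob_in_finite finite_support) measurable
    also have "\<dots> = ?W"
      by (simp add: prob_history_Suc finite_support sum_pmf_eq_1 flip: sum_distrib_left)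
    finally have "prob (?H - ?G) = 0"
      using finite_measure_Diff[OF sets] by (simp add: subset_eq)
    then have "AE \<omega> in M. \<omega> \<notin> ?H - ?G"
      using prob_eq_0[THEN iffD1, OF sets.Diff[OF sets]] by blast
    then show ?thesis by (rule AE_mp) (rule AE_I2, blast)
  qed
  then have "AE \<omega> in M. \<forall>x\<in>histories k. (\<forall>i\<le>k. X i \<omega> = x i) \<longrightarrow> X (Suc k) \<omega> \<in> set_pmf (K (x k))"
    by (intro AE_finite_allI finite_histories)
  with Suc show ?case
  proof eventually_elim
    case (elim \<omega>)
    have "history (Suc k) \<omega> = (history k \<omega>)(Suc k := X (Suc k) \<omega>)"
      by (auto simp: history_def fun_eq_iff)
    moreover have "\<forall>i\<le>k. X i \<omega> = history k \<omega> i" by (simp add: history_def)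
    ultimately show ?case
      using elim by (auto simp del: fun_upd_apply intro!: bexI[of _ "history k \<omega>"])
  qed
qed

text \<open>The transition rule conditions on entire histories. Since the kernel sees only the last
  state, summing over the histories that end in \<open>z\<close> leaves the Markov property for
  pairs.\<close>

lemma prob_pair:
  "\<P>(\<omega> in M. X k \<omega> = z \<and> X (Suc k) \<omega> = y) = \<P>(\<omega> in M. X k \<omega> = z) * pmf (K z) y"
proof -
  have ev: "{\<omega> \<in> space M. history k \<omega> = h} \<in> events" if "h \<in> histories k" for h
    by (simp add: history_eq_iff that)
  have "\<P>(\<omega> in M. X k \<omega> = z \<and> X (Suc k) \<omega> = y) =
    (\<Sum>h\<in>histories k. \<P>(\<omega> in M. history k \<omega> = h \<and> X k \<omega> = z \<and> X (Suc k) \<omega> = y))"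
    by (intro prob_sum_values finite_histories AE_history ev) auto
  also have "\<dots> = (\<Sum>h\<in>histories k. \<P>(\<omega> in M. history k \<omega> = h \<and> X k \<omega> = z) * pmf (K z) y)"
  proof (intro sum.cong refl)
    fix h assume h: "h \<in> histories k"
    show "\<P>(\<omega> in M. history k \<omega> = h \<and> X k \<omega> = z \<and> X (Suc k) \<omega> = y) =
      \<P>(\<omega> in M. history k \<omega> = h \<and> X k \<omega> = z) * pmf (K z) y"
    proof (cases "h k = z")
      case True
      have "\<P>(\<omega> in M. history k \<omega> = h \<and> X k \<omega> = z \<and> X (Suc k) \<omega> = y) =
        \<P>(\<omega> in M. (\<forall>i\<le>k. X i \<omega> = h i) \<and> X (Suc k) \<omega> = y)"
        using True by (intro arg_cong[where f = prob]) (auto simp: history_eq_iff h)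
      moreover have "\<P>(\<omega> in M. history k \<omega> = h \<and> X k \<omega> = z) = \<P>(\<omega> in M. \<forall>i\<le>k. X i \<omega> = h i)"
        using True by (intro arg_cong[where f = prob]) (auto simp: history_eq_iff h)
      ultimately show ?thesis using prob_history_Suc[of k h y] True by simp
    next
      case False
      then have "{\<omega> \<in> space M. history k \<omega> = h \<and> X k \<omega> = z} = {}"
        "{\<omega> \<in> space M. history k \<omega> = h \<and> X k \<omega> = z \<and> X (Suc k) \<omega> = y} = {}"
        by (auto simp: history_eq_iff h)
      then show ?thesis by (simp only: measure_empty mult_zero_left)
    qed
  qed
  also have "\<dots> = \<P>(\<omega> in M. X k \<omega> = z) * pmf (K z) y"
    unfolding sum_distrib_right[symmetric]
    by (subst prob_sum_values[OF finite_histories AE_history ev, where R = "\<lambda>\<omega>. X k \<omega> = z"]) auto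
  finally show ?thesis .
qed

lemma finite_marginal: "finite (set_pmf (marginal k))"
  by (induction k) (auto simp: finite_support)

text \<open>The two claims need a joint induction: computing the next law sums over the values of
  \<open>X k\<close>, which requires that these lie almost surely in a finite set.\<close>

lemma AE_marginal: "AE \<omega> in M. X k \<omega> \<in> set_pmf (marginal k)"
  and prob_marginal: "\<P>(\<omega> in M. X k \<omega> = z) = pmf (marginal k) z"
proof -
  have "(AE \<omega> in M. X k \<omega> \<in> set_pmf (marginal k)) \<and> (\<forall>z. \<P>(\<omega> in M. X k \<omega> = z) = pmf (marginal k) z)"
  proof (induction k)
    case 0
    have "\<P>(\<omega> in M. X 0 \<omega> = z) = pmf (marginal 0) z" for z
    proof (cases "z = x0")
      case True
      then show ?thesis using start prob_Collect_eq_1[of "\<lambda>\<omega>. X 0 \<omega> = z"] by simp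
    next
      case False
      then have "AE \<omega> in M. \<not> X 0 \<omega> = z" using start by auto
      then show ?thesis using False by (simp add: prob_eq_0_AE)
    qed
    with start show ?case by auto
  next
    case (Suc k)
    have 1: "\<P>(\<omega> in M. X (Suc k) \<omega> = y) = pmf (marginal (Suc k)) y" for y
    proof -
      have "\<P>(\<omega> in M. X (Suc k) \<omega> = y) =
        (\<Sum>z\<in>set_pmf (marginal k). \<P>(\<omega> in M. X k \<omega> = z \<and> X (Suc k) \<omega> = y))"
        using Suc by (intro prob_sum_values finite_marginal) auto
      also have "\<dots> = (\<Sum>z\<in>set_pmf (marginal k). pmf (K z) y * pmf (marginal k) z)"
        using Suc by (simp add: prob_pair mult.commute)
      also have "\<dots> = pmf (marginal (Suc k)) y"
        by (simp add: pmf_bind integral_measure_pmf_real[OF finite_marginal])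
      finally show ?thesis .
    qed
    let ?G = "{\<omega> \<in> space M. X (Suc k) \<omega> \<in> set_pmf (marginal (Suc k))}"
    have "set_pmf (marginal (Suc k)) \<in> sets borel"
      by (intro borel_closed finite_imp_closed finite_marginal)
    then have sets: "?G \<in> events" by measurable
    have "prob ?G = (\<Sum>y\<in>set_pmf (marginal (Suc k)). \<P>(\<omega> in M. X (Suc k) \<omega> = y))"
      using prob_in_finite[OF finite_marginal[of "Suc k"], where R = "\<lambda>_. True" and Y = "X (Suc k)"]
      by (simp del: marginal.simps)
    also have "\<dots> = 1"
      unfolding 1 by (rule sum_pmf_eq_1[OF finite_marginal]) simp
    finally have "AE \<omega> in M. X (Suc k) \<omega> \<in> set_pmf (marginal (Suc k))"
      using sets by (subst (asm) prob_Collect_eq_1)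
    with 1 show ?case by blast
  qed
  then show "AE \<omega> in M. X k \<omega> \<in> set_pmf (marginal k)" "\<P>(\<omega> in M. X k \<omega> = z) = pmf (marginal k) z"
    by auto
qed

text \<open>Almost surely the pair takes finitely many values, so the integral is a finite sum
  weighted by \<open>prob_pair\<close>, and \<open>h\<close> may be any nonnegative function. This
  transfers bounds on one step of the kernel to the process on \<open>M\<close>.\<close>

lemma nn_integral_pair:
  fixes h :: "'a \<Rightarrow> 'a \<Rightarrow> real"
  assumes "\<And>x y. h x y \<ge> 0" 
  shows "(\<integral>\<^sup>+\<omega>. ennreal (h (X k \<omega>) (X (Suc k) \<omega>)) \<partial>M) =
    ennreal (measure_pmf.expectation (marginal k) (\<lambda>x. measure_pmf.expectation (K x) (h x)))"
proof -
  let ?I = "SIGMA z : set_pmf (marginal k). set_pmf (K z)"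
  have fin: "finite ?I" by (auto simp: finite_marginal finite_support)
  have "y (Suc k) \<in> set_pmf (K (y k))" if "y \<in> histories (Suc k)" for y
    using that by auto
  note succ = this
  have sub: "AE \<omega> in M. (X k \<omega>, X (Suc k) \<omega>) \<in> ?I"
    using AE_history[of "Suc k"] AE_marginal[of k]
  proof eventually_elim
    case (elim \<omega>)
    then show ?case using succ[OF elim(1)] by (simp add: history_def)
  qed
  have "(\<integral>\<^sup>+\<omega>. ennreal (h (X k \<omega>) (X (Suc k) \<omega>)) \<partial>M) =
    (\<integral>\<^sup>+\<omega>. (\<Sum>(z, y)\<in>?I. ennreal (h z y) * indicator {\<omega> \<in> space M. X k \<omega> = z \<and> X (Suc k) \<omega> = y} \<omega>) \<partial>M)"
  proof (rule nn_integral_cong_AE, use sub AE_space in eventually_elim)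
    case (elim \<omega>)
    have "(\<Sum>(z, y)\<in>?I. ennreal (h z y) * indicator {\<omega> \<in> space M. X k \<omega> = z \<and> X (Suc k) \<omega> = y} \<omega>) =
      (\<Sum>zy\<in>{(X k \<omega>, X (Suc k) \<omega>)}. ennreal (h (fst zy) (snd zy)))"
      using elim fin by (intro sum.mono_neutral_cong_right) (auto simp: indicator_def split: if_splits)
    then show ?case by simp
  qed
  also have "\<dots> = (\<Sum>(z, y)\<in>?I. ennreal (h z y) * emeasure M {\<omega> \<in> space M. X k \<omega> = z \<and> X (Suc k) \<omega> = y})"
    by (subst nn_integral_sum) (auto simp: case_prod_beta nn_integral_cmult_indicator intro!: sum.cong)
  also have "\<dots> = (\<Sum>(z, y)\<in>?I. ennreal (h z y * (pmf (marginal k) z * pmf (K z) y)))"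
    using prob_pair prob_marginal
    by (intro sum.cong) (auto simp: emeasure_eq_measure ennreal_mult assms)
  also have "\<dots> = ennreal (\<Sum>(z, y)\<in>?I. h z y * (pmf (marginal k) z * pmf (K z) y))"
    by (subst sum_ennreal[symmetric]) (auto simp: assms case_prod_beta)
  also have "(\<Sum>(z, y)\<in>?I. h z y * (pmf (marginal k) z * pmf (K z) y)) =
     measure_pmf.expectation (marginal k) (\<lambda>x. measure_pmf.expectation (K x) (h x))"
    by (simp add: integral_measure_pmf_real[OF finite_marginal] integral_measure_pmf_real[OF finite_support]
       sum.Sigma[symmetric] finite_marginal finite_support sum_distrib_left sum_distrib_right mult_ac)
  finally show ?thesis .
qed

end

section \<open>Expected decrease of the energy\<close>


lemma norm_vec_squared: "(norm x)\<^sup>2 = (\<Sum>i\<in>UNIV. (norm (x $ i))\<^sup>2)"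
  by (simp add: norm_vec_def L2_set_def sum_nonneg)

lemma norm_sum_components_squared_le:
  fixes x :: "'a::real_normed_vector ^ 'n"
  shows "(norm (\<Sum>i\<in>UNIV. x $ i))\<^sup>2 \<le> real CARD('n) * (norm x)\<^sup>2"
  using norm_sum_squared_le[of "\<lambda>i. x $ i" UNIV] by (simp add: norm_vec_squared)

lemma slot_less_iff: "slot s < slot t \<longleftrightarrow> s < (t :: 't :: {finite, linorder})"
proof -
  have *: "slot s < slot t" if "s < t" for s t :: 't
    unfolding slot_def using that by (intro psubset_card_mono) (auto dest: leD)
  show ?thesis using *[of s t] *[of t s] by (metis less_asym linorder_neqE order_less_irrefl)
qed

lemma bij_betw_slot: "bij_betw slot (UNIV :: 't :: {finite, linorder} set) {1..CARD('t)}"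
proof -
  have inj: "inj (slot :: 't \<Rightarrow> nat)"
    using slot_less_iff by (metis injI linorder_neqE order_less_irrefl)
  have "slot t \<in> {1..CARD('t)}" for t :: 't
    using card_mono[of UNIV "{..t}"] card_gt_0_iff[of "{..t}"] by (auto simp: slot_def Suc_le_eq)
  then have "range (slot :: 't \<Rightarrow> nat) = {1..CARD('t)}"
    by (intro card_subset_eq) (auto simp: card_image[OF inj])
  with inj show ?thesis by (simp add: bij_betw_def)
qed

lemma finite_blocks: "finite (blocks S n)"
  by (simp add: blocks_def)

lemma norm_block:
  fixes S :: "('t :: {finite, linorder}, 'n) da_problem"
  assumes "valid_problem S" "n \<notin> cont_das S" "a \<in> {1..shifts S n}"
  shows "(norm (block S n a))\<^sup>2 = real (duration S n) * (rate S n)\<^sup>2"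
proof -
  let ?lo = "arrival S n + a - 1" and ?hi = "arrival S n + a + duration S n - 2"
  have ok: "duration S n \<ge> 1" "arrival S n \<ge> 1" "deadline S n \<le> CARD('t) + 1"
    using assms by (auto simp: valid_problem_def)
  have "(norm (block S n a))\<^sup>2 = (\<Sum>(t::'t)\<in>UNIV. if ?lo \<le> slot t \<and> slot t \<le> ?hi then (rate S n)\<^sup>2 else 0)"
    by (simp add: norm_vec_squared block_def if_distrib[of "\<lambda>x. x\<^sup>2"] cong: if_cong)
  also have "\<dots> = real (card {t::'t. slot t \<in> {?lo..?hi}}) * (rate S n)\<^sup>2"
    by (simp flip: sum.inter_filter)
  also have "card {t::'t. slot t \<in> {?lo..?hi}} = card (slot ` {t::'t. slot t \<in> {?lo..?hi}})"
    using bij_betw_slot by (intro card_image[symmetric]) (auto simp: bij_betw_def intro: inj_on_subset)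
  also have "slot ` {t::'t. slot t \<in> {?lo..?hi}} = {?lo..?hi} \<inter> range (slot :: 't \<Rightarrow> nat)"
    by auto
  \<comment> \<open>The block stays inside the horizon: \<open>arrival S n \<ge> 1\<close> and
    \<open>a \<ge> 1\<close> give a first slot of at least 1, and \<open>a \<le> shifts S n\<close>
    gives a last slot of at most \<open>deadline S n - 1\<close>, hence at most the number of slots.
    No truncated subtraction is in effect.\<close>
  also have "\<dots> = {?lo..?hi}"
    using assms(3) ok bij_betw_slot[where 't = 't] by (auto simp: bij_betw_def shifts_def)
  also have "card {?lo..?hi} = duration S n"
    using ok assms(3) by auto
  finally show ?thesis .
qed

locale off_ds =
  fixes S :: "('t :: {finite, linorder}, 'n :: finite) da_problem"
  assumes two_das: "CARD('n) \<ge> 2" and valid: "valid_problem S"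
begin


text \<open>The convex set onto which an application projects. For a continuous one the hull adds
  nothing; for a discrete one it is the domain of the relaxed problem.\<close>

definition region :: "'n \<Rightarrow> 't traffic set" where
  "region n = convex hull (feasible_set S n)"

definition load :: "('t, 'n) profile \<Rightarrow> 't traffic" where
  "load p = base S + (\<Sum>n\<in>UNIV. p $ n)"

definition energy :: "('t, 'n) profile \<Rightarrow> real" where
  "energy p = (norm (load p))\<^sup>2"

text \<open>This is the conditional expectation of the next profile, because the random block of a
  discrete application has the relaxed minimiser as its mean.\<close>

definition mean_update :: "('t, 'n) profile \<Rightarrow> ('t, 'n) profile" where
  "mean_update p = (\<chi> n. if n \<in> cont_das S then cont_update S p n else disc_relaxed S p n)"

definition drift :: "('t, 'n) profile \<Rightarrow> ('t, 'n) profile" where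
  "drift p = mean_update p - p"

definition shift_choice :: "('t, 'n) profile \<Rightarrow> ('n \<Rightarrow> nat) pmf" where
  "shift_choice p = Pi_pmf (disc_das S) undefined (shift_weights S p)"

definition next_profile :: "('t, 'n) profile \<Rightarrow> ('n \<Rightarrow> nat) \<Rightarrow> ('t, 'n) profile" where
  "next_profile p a = (\<chi> n. if n \<in> cont_das S then cont_update S p n else block S n (a n))"

lemma step_eq: "step S p = map_pmf (next_profile p) (shift_choice p)"
  by (simp add: step_def next_profile_def[abs_def] shift_choice_def)

lemma card_ge_2: "real CARD('n) \<ge> 2" using two_das by linarith

lemma feasible_set_cont_eq:
  assumes "n \<in> cont_das S"
  shows "feasible_set S n = cbox (lower S n) (upper S n) \<inter> {x. (\<Sum>t\<in>UNIV. x $ t) = total S n}"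
  using assms by (auto simp: feasible_set_def mem_box_cart)

lemma feasible_set_disc_eq: "n \<notin> cont_das S \<Longrightarrow> feasible_set S n = blocks S n"
  by (simp add: feasible_set_def)

lemma feasible_set_nonempty: "feasible_set S n \<noteq> {}"
  using valid by (cases "n \<in> cont_das S") (auto simp: valid_problem_def)

lemma compact_feasible_set: "compact (feasible_set S n)"
proof (cases "n \<in> cont_das S")
  case True
  then show ?thesis
    by (simp add: feasible_set_cont_eq compact_Int_closed compact_cbox closed_Collect_eq continuous_intros)
qed (simp add: feasible_set_disc_eq finite_blocks finite_imp_compact)

lemma convex_feasible_set_cont:
  assumes "n \<in> cont_das S"
  shows "convex (feasible_set S n)"
proof -
  have "convex {x :: 't traffic. (\<Sum>t\<in>UNIV. x $ t) = total S n}"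
    by (auto simp: convex_def sum.distrib simp flip: sum_distrib_left distrib_right)
  then show ?thesis using assms by (auto simp: feasible_set_cont_eq intro!: convex_Int)
qed

lemma region_cont: "n \<in> cont_das S \<Longrightarrow> region n = feasible_set S n"
  by (simp add: region_def convex_feasible_set_cont hull_same)

lemma feasible_set_subset_region: "feasible_set S n \<subseteq> region n"
  by (simp add: region_def hull_subset)

lemma compact_region: "compact (region n)" and convex_region: "convex (region n)"
  and region_nonempty: "region n \<noteq> {}" and closed_region: "closed (region n)"
  using compact_feasible_set feasible_set_nonempty
  by (auto simp: region_def compact_convex_hull compact_imp_closed)

lemma feasible_in_region: "feasible S p \<Longrightarrow> p $ n \<in> region n"
  using feasible_set_subset_region by (auto simp: feasible_def)

lemma average_profile_eq: "average_profile S p = load p /\<^sub>R real CARD('n)"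
  by (simp add: average_profile_def load_def inverse_eq_divide)

lemma mean_update_cont:
  assumes "n \<in> cont_das S"
  shows "mean_update p $ n = closest_point (region n) (p $ n - load p /\<^sub>R real CARD('n))"
proof -
  have "cont_update S p n = closest_point (feasible_set S n) (p $ n - load p /\<^sub>R real CARD('n))"
    unfolding cont_update_def
    using arg_min_on_norm_eq_closest_point[of "feasible_set S n" "p $ n - load p /\<^sub>R real CARD('n)"]
      assms convex_feasible_set_cont feasible_set_nonempty compact_feasible_set
    by (simp add: average_profile_eq compact_imp_closed algebra_simps)
  then show ?thesis using assms by (simp add: mean_update_def region_cont)
qed

lemma mean_update_disc:
  assumes "n \<notin> cont_das S"
  shows "mean_update p $ n = closest_point (region n) ((real CARD('n) *\<^sub>R p $ n - load p) /\<^sub>R (real CARD('n) - 1))"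
proof -
  have "(real CARD('n) / (real CARD('n) - 1)) *\<^sub>R (p $ n - average_profile S p) = (real CARD('n) *\<^sub>R p $ n - load p) /\<^sub>R (real CARD('n) - 1)"
    using card_ge_2 by (simp add: average_profile_eq scaleR_diff_right divide_inverse mult.commute)
  then show ?thesis
    using assms arg_min_on_norm_eq_closest_point[OF closed_region convex_region region_nonempty, of _ n]
    by (simp add: mean_update_def disc_relaxed_def region_def feasible_set_disc_eq)
qed

lemma mean_update_in_region: "mean_update p $ n \<in> region n"
  by (cases "n \<in> cont_das S")
    (simp_all add: mean_update_cont mean_update_disc closest_point_in_set closed_region region_nonempty)

text \<open>Projections onto closed convex sets are continuous. This is what lets the drift pass to
  the limit of a convergent path.\<close>

lemma continuous_on_mean_update: "continuous_on UNIV mean_update"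
proof -
  have load: "continuous_on UNIV load" unfolding load_def by (intro continuous_intros)
  have "continuous_on UNIV (\<lambda>p. mean_update p $ n)" for n
  proof -
    have "continuous_on UNIV (\<lambda>p. closest_point (region n) (f p))" if "continuous_on UNIV f"
      for f :: "('t, 'n) profile \<Rightarrow> _"
      by (rule continuous_on_compose2[OF continuous_on_closest_point[OF convex_region closed_region region_nonempty] that]) auto
    then show ?thesis
      by (cases "n \<in> cont_das S") (simp_all add: mean_update_cont mean_update_disc load continuous_intros)
  qed
  then have "continuous_on UNIV (\<lambda>p. \<chi> n. mean_update p $ n)" by (rule continuous_on_vec_lambda)
  then show ?thesis by simp
qed

lemma continuous_on_drift: "continuous_on UNIV drift"
  unfolding drift_def by (intro continuous_intros continuous_on_mean_update)

text \<open>The obtuse angle condition of the projection, multiplied by the number of applications: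
  the update is a proximal step for the linear function with gradient \<open>load p\<close>.\<close>

lemma cont_variational:
  assumes "n \<in> cont_das S" "y \<in> region n"
  shows "0 \<le> (real CARD('n) *\<^sub>R drift p $ n + load p) \<bullet> (y - mean_update p $ n)"
proof -
  have "0 \<le> real CARD('n) * ((mean_update p $ n - (p $ n - load p /\<^sub>R real CARD('n))) \<bullet> (y - mean_update p $ n))"
    using closest_point_inner_le[OF closed_region convex_region assms(2)] assms(1)
    by (intro mult_nonneg_nonneg) (simp_all add: mean_update_cont)
  also have "\<dots> = (real CARD('n) *\<^sub>R (mean_update p $ n - (p $ n - load p /\<^sub>R real CARD('n)))) \<bullet> (y - mean_update p $ n)"
    by simp
  also have "real CARD('n) *\<^sub>R (mean_update p $ n - (p $ n - load p /\<^sub>R real CARD('n))) = real CARD('n) *\<^sub>R drift p $ n + load p"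
    using card_ge_2 by (simp add: drift_def algebra_simps)
  finally show ?thesis .
qed

text \<open>The same condition after multiplication by \<open>real CARD('n) - 1\<close>. The
  gradient is now \<open>load p - p $ n\<close>, the load of everything but application
  \<open>n\<close>; this form results from the factor N/(N-1) in the algorithm.\<close>

lemma disc_variational:
  assumes "n \<notin> cont_das S" "y \<in> region n"
  shows "0 \<le> ((real CARD('n) - 1) *\<^sub>R drift p $ n + load p - p $ n) \<bullet> (y - mean_update p $ n)"
proof -
  let ?g = "(real CARD('n) *\<^sub>R p $ n - load p) /\<^sub>R (real CARD('n) - 1)"
  have "0 \<le> (real CARD('n) - 1) * ((mean_update p $ n - ?g) \<bullet> (y - mean_update p $ n))"
    using closest_point_inner_le[OF closed_region convex_region assms(2)] assms(1) card_ge_2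
    by (intro mult_nonneg_nonneg) (simp_all add: mean_update_disc)
  also have "\<dots> = ((real CARD('n) - 1) *\<^sub>R (mean_update p $ n - ?g)) \<bullet> (y - mean_update p $ n)"
    by simp
  also have "(real CARD('n) - 1) *\<^sub>R (mean_update p $ n - ?g) =
      (real CARD('n) - 1) *\<^sub>R mean_update p $ n - (real CARD('n) *\<^sub>R p $ n - load p)"
    using card_ge_2 by (simp add: scaleR_diff_right)
  also have "\<dots> = (real CARD('n) - 1) *\<^sub>R drift p $ n + load p - p $ n"
    by (simp add: drift_def algebra_simps)
  finally show ?thesis .
qed

lemma disc_norm_eq:
  assumes "n \<notin> cont_das S" "f \<in> feasible_set S n" "g \<in> feasible_set S n"
  shows "norm f = norm g"
proof -
  obtain a b where "f = block S n a" "a \<in> {1..shifts S n}" "g = block S n b" "b \<in> {1..shifts S n}"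
    using assms by (auto simp: feasible_set_disc_eq blocks_def)
  then have "(norm f)\<^sup>2 = (norm g)\<^sup>2"
    using norm_block[OF valid assms(1)] by metis
  then show ?thesis by simp
qed

lemma shift_weights:
  assumes "n \<notin> cont_das S"
  shows set_shift_weights: "set_pmf (shift_weights S p n) \<subseteq> {1..shifts S n}"
    and expectation_shift_weights:
      "measure_pmf.expectation (shift_weights S p n) (block S n) = mean_update p $ n"
proof -
  have "mean_update p $ n \<in> convex hull (block S n ` {1..shifts S n})"
    using mean_update_in_region[of p n] assms by (simp add: region_def feasible_set_disc_eq blocks_def)
  from convex_hull_image_pmf[OF _ this]
  have "\<exists>u. set_pmf u \<subseteq> {1..shifts S n} \<and> disc_relaxed S p n = (\<Sum>a = 1..shifts S n. pmf u a *\<^sub>R block S n a)"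
    using assms by (simp add: mean_update_def)
  from someI_ex[OF this]
  have *: "set_pmf (shift_weights S p n) \<subseteq> {1..shifts S n}"
    "disc_relaxed S p n = (\<Sum>a = 1..shifts S n. pmf (shift_weights S p n) a *\<^sub>R block S n a)"
    by (auto simp: shift_weights_def)
  then show "set_pmf (shift_weights S p n) \<subseteq> {1..shifts S n}" by simp
  have "measure_pmf.expectation (shift_weights S p n) (block S n) =
    (\<Sum>a = 1..shifts S n. pmf (shift_weights S p n) a *\<^sub>R block S n a)"
    using *(1) by (intro integral_measure_pmf) auto
  then show "measure_pmf.expectation (shift_weights S p n) (block S n) = mean_update p $ n"
    using *(2) assms by (simp add: mean_update_def)
qed

lemma finite_shift_weights: "n \<notin> cont_das S \<Longrightarrow> finite (set_pmf (shift_weights S p n))"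
  using set_shift_weights finite_subset by blast

lemma finite_shift_choice: "finite (set_pmf (shift_choice p))"
  by (auto simp: shift_choice_def set_Pi_pmf finite_shift_weights intro!: finite_PiE_dflt)

lemma integrable_shift_choice [simp]: "integrable (measure_pmf (shift_choice p)) f"
  for f :: "_ \<Rightarrow> 'c :: {banach, second_countable_topology}"
  by (intro integrable_measure_pmf_finite finite_shift_choice)

lemma finite_step: "finite (set_pmf (step S p))"
  by (simp add: step_eq finite_shift_choice)

lemma shift_choice_in:
  "a \<in> set_pmf (shift_choice p) \<Longrightarrow> n \<notin> cont_das S \<Longrightarrow> a n \<in> set_pmf (shift_weights S p n)"
  by (auto simp: shift_choice_def set_Pi_pmf PiE_dflt_def)

lemma block_feasible:
  "n \<notin> cont_das S \<Longrightarrow> a \<in> set_pmf (shift_weights S p n) \<Longrightarrow> block S n a \<in> feasible_set S n"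
  using set_shift_weights by (auto simp: feasible_set_disc_eq blocks_def)

lemma feasible_next_profile:
  assumes "a \<in> set_pmf (shift_choice p)"
  shows "feasible S (next_profile p a)"
  unfolding feasible_def
proof
  fix n
  show "next_profile p a $ n \<in> feasible_set S n"
    using mean_update_in_region[of p n] shift_choice_in[OF assms, of n] block_feasible[of n]
    by (cases "n \<in> cont_das S") (auto simp: next_profile_def mean_update_def region_cont)
qed

lemma feasible_step: "p' \<in> set_pmf (step S p) \<Longrightarrow> feasible S p'"
  by (auto simp: step_eq feasible_next_profile)

lemma expectation_shift_choice:
  fixes f :: "nat \<Rightarrow> 'c :: {banach, second_countable_topology}"
  assumes "n \<notin> cont_das S"
  shows "measure_pmf.expectation (shift_choice p) (\<lambda>a. f (a n)) = measure_pmf.expectation (shift_weights S p n) f"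
  unfolding shift_choice_def using assms by (intro expectation_Pi_pmf_component) auto

lemma expectation_shift_choice_mult:
  fixes f g :: "nat \<Rightarrow> real"
  assumes "n \<notin> cont_das S" "m \<notin> cont_das S" "n \<noteq> m"
  shows "measure_pmf.expectation (shift_choice p) (\<lambda>a. f (a n) * g (a m)) =
    measure_pmf.expectation (shift_weights S p n) f * measure_pmf.expectation (shift_weights S p m) g"
  unfolding shift_choice_def using assms finite_shift_weights by (intro expectation_Pi_pmf_mult) auto

lemma expectation_inner_block:
  assumes "n \<notin> cont_das S"
  shows "measure_pmf.expectation (shift_weights S p n) (\<lambda>a. c \<bullet> (block S n a - mean_update p $ n)) = 0"
proof -
  note int = integrable_measure_pmf_finite[OF finite_shift_weights[OF assms]]
  show ?thesis
    by (simp add: int expectation_shift_weights[OF assms])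
qed

text \<open>
  The blocks of an application all have the same norm, so the variance of its random choice is
  the difference of the squared norms.
\<close>

lemma expectation_energy:
  assumes "feasible S p"
  shows "measure_pmf.expectation (step S p) energy =
    energy (mean_update p) + (\<Sum>n\<in>disc_das S. (norm (p $ n))\<^sup>2 - (norm (mean_update p $ n))\<^sup>2)"
proof -
  let ?E = "measure_pmf.expectation (shift_choice p)"
  define \<xi> where "\<xi> n a = block S n (a n) - mean_update p $ n" for n and a :: "'n \<Rightarrow> nat"
  have next_eq: "next_profile p a = mean_update p + (\<chi> n. if n \<in> disc_das S then \<xi> n a else 0)" for a
    by (auto simp: next_profile_def mean_update_def \<xi>_def vec_eq_iff)
  have "(\<Sum>n\<in>UNIV. if n \<in> disc_das S then \<xi> n a else 0) = (\<Sum>n\<in>disc_das S. \<xi> n a)" for a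
    by (subst sum.inter_restrict[symmetric]) auto
  then have "load (next_profile p a) = load (mean_update p) + (\<Sum>n\<in>disc_das S. \<xi> n a)" for a
    by (simp add: next_eq load_def sum.distrib algebra_simps)
  then have energy_eq: "energy (next_profile p a) = energy (mean_update p) +
      2 * (\<Sum>n\<in>disc_das S. load (mean_update p) \<bullet> \<xi> n a) +
      (\<Sum>n\<in>disc_das S. \<Sum>m\<in>disc_das S. \<xi> n a \<bullet> \<xi> m a)" for a
    by (simp add: energy_def power2_norm_eq_inner inner_add_left inner_add_right inner_sum_left
        inner_sum_right inner_commute algebra_simps)
  have lin: "?E (\<lambda>a. c \<bullet> \<xi> n a) = 0" if "n \<in> disc_das S" for n c
    unfolding \<xi>_def using that expectation_inner_block
    by (subst expectation_shift_choice) auto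
  have "?E (\<lambda>a. \<xi> n a \<bullet> \<xi> m a) =
      (if n = m then (norm (p $ n))\<^sup>2 - (norm (mean_update p $ n))\<^sup>2 else 0)"
    if nm: "n \<in> disc_das S" "m \<in> disc_das S" for n m
  proof (cases "n = m")
    case True
    \<comment> \<open>With the norm of the block replaced by that of \<open>p $ n\<close>, the
      square becomes a constant plus a term linear in the centred variable, whose mean is 0.\<close>
    have "\<xi> n a \<bullet> \<xi> n a = (norm (p $ n))\<^sup>2 - (norm (mean_update p $ n))\<^sup>2 - 2 * (mean_update p $ n \<bullet> \<xi> n a)"
      if "a \<in> set_pmf (shift_choice p)" for a
    proof -
      have "norm (block S n (a n)) = norm (p $ n)"
        using nm that assms by (intro disc_norm_eq[of n] block_feasible shift_choice_in) (auto simp: feasible_def)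
      then have "(block S n (a n)) \<bullet> (block S n (a n)) = (norm (p $ n))\<^sup>2"
        by (metis power2_norm_eq_inner)
      then show ?thesis
        unfolding \<xi>_def by (simp add: power2_norm_eq_inner algebra_simps inner_commute)
    qed
    then have "?E (\<lambda>a. \<xi> n a \<bullet> \<xi> n a) =
       ?E (\<lambda>a. (norm (p $ n))\<^sup>2 - (norm (mean_update p $ n))\<^sup>2 - 2 * (mean_update p $ n \<bullet> \<xi> n a))"
      by (intro integral_cong_AE) (auto simp: AE_measure_pmf_iff)
    then show ?thesis using True lin nm by simp
  next
    case False
    \<comment> \<open>The product formula is for real functions, so the inner product is split into
      coordinates before independence is applied.\<close>
    have "?E (\<lambda>a. \<xi> n a \<bullet> \<xi> m a) = (\<Sum>t\<in>UNIV. ?E (\<lambda>a. (axis t 1 \<bullet> \<xi> n a) * (axis t 1 \<bullet> \<xi> m a)))"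
      by (simp add: inner_vec_def[of "\<xi> _ _"] inner_axis')
    also have "\<dots> = 0"
      unfolding \<xi>_def using nm False
      by (intro sum.neutral ballI)
        (simp add: expectation_shift_choice_mult[where f = "\<lambda>a. axis _ 1 \<bullet> (block S n a - mean_update p $ n)"
            and g = "\<lambda>a. axis _ 1 \<bullet> (block S m a - mean_update p $ m)"] expectation_inner_block del: inner_diff_right)
    finally show ?thesis using False by simp
  qed
  then have quad: "?E (\<lambda>a. \<Sum>n\<in>disc_das S. \<Sum>m\<in>disc_das S. \<xi> n a \<bullet> \<xi> m a) =
      (\<Sum>n\<in>disc_das S. (norm (p $ n))\<^sup>2 - (norm (mean_update p $ n))\<^sup>2)"
    by (simp add: sum.delta cong: if_cong)
  have "measure_pmf.expectation (step S p) energy = ?E (\<lambda>a. energy (next_profile p a))"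
    by (simp add: step_eq)
  also have "\<dots> = energy (mean_update p) + (\<Sum>n\<in>disc_das S. (norm (p $ n))\<^sup>2 - (norm (mean_update p $ n))\<^sup>2)"
    unfolding energy_eq using quad lin by simp
  finally show ?thesis .
qed

text \<open>Cauchy-Schwarz bounds the square of the total change by N times the sum of the squares.
  This decouples the applications and accounts for the factor N in their proximal terms.\<close>

lemma energy_add_le:
  "energy (p + x) \<le> energy p + (\<Sum>n\<in>UNIV. 2 * (load p \<bullet> x $ n) + real CARD('n) * (norm (x $ n))\<^sup>2)"
proof -
  have "load (p + x) = load p + (\<Sum>n\<in>UNIV. x $ n)" by (simp add: load_def sum.distrib)
  then have "energy (p + x) = energy p + 2 * (load p \<bullet> (\<Sum>n\<in>UNIV. x $ n)) + (norm (\<Sum>n\<in>UNIV. x $ n))\<^sup>2"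
    unfolding energy_def power2_norm_eq_inner by (simp add: inner_add_left inner_add_right inner_commute)
  then show ?thesis
    using norm_sum_components_squared_le[of x]
    by (simp add: norm_vec_squared sum.distrib inner_sum_right sum_distrib_left)
qed

text \<open>Each application is treated separately, with its variational inequality tested at
  \<open>p $ n\<close>. For a discrete one the variance equals -2 p\<bullet>\<delta> -
  \<parallel>\<delta>\<parallel> squared; added to the bound of \<open>energy_add_le\<close> it
  replaces the load by the load of the others and N by N - 1, exactly the terms of
  \<open>disc_variational\<close>.\<close>

lemma energy_decreases:
  assumes "feasible S p"
  shows "measure_pmf.expectation (step S p) energy \<le> energy p - (real CARD('n) - 1) * (norm (drift p))\<^sup>2"
proof -
  let ?\<delta> = "\<lambda>n. drift p $ n"
  let ?v = "\<lambda>n. (norm (p $ n))\<^sup>2 - (norm (mean_update p $ n))\<^sup>2"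
  have upd: "mean_update p = p + drift p" by (simp add: drift_def)
  have bound: "2 * (load p \<bullet> ?\<delta> n) + real CARD('n) * (norm (?\<delta> n))\<^sup>2 + (if n \<in> disc_das S then ?v n else 0)
      \<le> - (real CARD('n) - 1) * (norm (?\<delta> n))\<^sup>2" for n
  proof (cases "n \<in> cont_das S")
    case True
    have "0 \<le> (real CARD('n) *\<^sub>R ?\<delta> n + load p) \<bullet> (p $ n - mean_update p $ n)"
      using True assms by (intro cont_variational feasible_in_region)
    then have "load p \<bullet> ?\<delta> n + real CARD('n) * (norm (?\<delta> n))\<^sup>2 \<le> 0"
      by (simp add: upd inner_add_left power2_norm_eq_inner)
    moreover have "0 \<le> (norm (?\<delta> n))\<^sup>2" by simp
    ultimately have "2 * (load p \<bullet> ?\<delta> n) + real CARD('n) * (norm (?\<delta> n))\<^sup>2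
        \<le> - (real CARD('n) - 1) * (norm (?\<delta> n))\<^sup>2"
      unfolding minus_mult_left[symmetric] left_diff_distrib by linarith
    then show ?thesis using True by simp
  next
    case False
    have "0 \<le> ((real CARD('n) - 1) *\<^sub>R ?\<delta> n + load p - p $ n) \<bullet> (p $ n - mean_update p $ n)"
      using False assms by (intro disc_variational feasible_in_region)
    then have "load p \<bullet> ?\<delta> n - p $ n \<bullet> ?\<delta> n + (real CARD('n) - 1) * (norm (?\<delta> n))\<^sup>2 \<le> 0"
      by (simp add: upd inner_add_left inner_diff_left power2_norm_eq_inner algebra_simps)
    moreover have "?v n = - 2 * (p $ n \<bullet> ?\<delta> n) - (norm (?\<delta> n))\<^sup>2"
      by (simp add: upd power2_norm_eq_inner inner_add_left inner_add_right inner_commute)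
    ultimately show ?thesis using False by (simp add: algebra_simps)
  qed
  have "energy (mean_update p) + (\<Sum>n\<in>disc_das S. ?v n) \<le>
      energy p + (\<Sum>n\<in>UNIV. 2 * (load p \<bullet> ?\<delta> n) + real CARD('n) * (norm (?\<delta> n))\<^sup>2) + (\<Sum>n\<in>UNIV. if n \<in> disc_das S then ?v n else 0)"
    using energy_add_le[of p "drift p"] by (simp add: upd Compl_eq flip: sum.inter_filter)
  also have "\<dots> = energy p + (\<Sum>n\<in>UNIV. 2 * (load p \<bullet> ?\<delta> n) + real CARD('n) * (norm (?\<delta> n))\<^sup>2 + (if n \<in> disc_das S then ?v n else 0))"
    by (simp add: sum.distrib)
  also have "\<dots> \<le> energy p + (\<Sum>n\<in>UNIV. - (real CARD('n) - 1) * (norm (?\<delta> n))\<^sup>2)"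
    by (intro add_left_mono sum_mono bound)
  also have "\<dots> = energy p - (real CARD('n) - 1) * (norm (drift p))\<^sup>2"
    unfolding norm_vec_squared[of "drift p"] sum_distrib_left[symmetric] by (simp add: algebra_simps)
  finally show ?thesis by (simp add: expectation_energy[OF assms])
qed

end

section \<open>The continuous applications\<close>


lemma norm_vec_le_sum: "norm x \<le> (\<Sum>i\<in>UNIV. norm (x $ i))"
  by (simp add: norm_vec_def L2_set_le_sum)

lemma norm_sum_components_le:
  fixes x :: "'a::real_normed_vector ^ 'n"
  shows "norm (\<Sum>i\<in>UNIV. x $ i) \<le> real CARD('n) * norm x"
proof -
  have "norm (\<Sum>i\<in>UNIV. x $ i) \<le> (\<Sum>i\<in>(UNIV::'n set). norm x)"
    by (intro sum_norm_le Finite_Cartesian_Product.norm_nth_le)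
  then show ?thesis by simp
qed

context off_ds
begin

definition slice :: "('t, 'n) profile \<Rightarrow> ('t, 'n) profile set" where
  "slice p = {p'. \<forall>n. if n \<in> cont_das S then p' $ n \<in> feasible_set S n else p' $ n = p $ n}"

definition optimum :: "('t, 'n) profile \<Rightarrow> ('t, 'n) profile" where
  "optimum p = (SOME x. x \<in> slice p \<and> (\<forall>y\<in>slice p. energy x \<le> energy y))"

definition level :: "('t, 'n) profile \<Rightarrow> real" where
  "level p = energy (optimum p)"

definition no_switch :: "('t, 'n) profile \<Rightarrow> ('t, 'n) profile" where
  "no_switch p = (\<chi> n. if n \<in> cont_das S then mean_update p $ n else p $ n)"

lemma self_in_slice: "feasible S p \<Longrightarrow> p \<in> slice p"
  by (auto simp: slice_def feasible_def)

lemma slice_feasible: "feasible S p \<Longrightarrow> p' \<in> slice p \<Longrightarrow> feasible S p'"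
  unfolding feasible_def slice_def by (metis (mono_tags, lifting) mem_Collect_eq)

lemma slice_cong: "(\<And>n. n \<notin> cont_das S \<Longrightarrow> p $ n = p' $ n) \<Longrightarrow> slice p = slice p'"
  by (simp add: slice_def cong: if_cong)

text \<open>A minimiser in a slice need not be unique, but it is chosen from the slice as a set, so
  the choice depends on the discrete profiles only. Finiteness of the optima rests on this.\<close>

lemma optimum_cong: "(\<And>n. n \<notin> cont_das S \<Longrightarrow> p $ n = p' $ n) \<Longrightarrow> optimum p = optimum p'"
  unfolding optimum_def using slice_cong[of p p'] by simp

lemma slice_disc: "p' \<in> slice p \<Longrightarrow> n \<notin> cont_das S \<Longrightarrow> p' $ n = p $ n"
  unfolding slice_def by (auto dest: spec[of _ n])

lemma compact_slice: "compact (slice p)"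
proof -
  let ?F = "\<lambda>n. if n \<in> cont_das S then feasible_set S n else {p $ n}"
  have F: "compact (?F n)" for n by (simp add: compact_feasible_set)
  have "slice p = (\<Inter>n. (\<lambda>p'. p' $ n) -` ?F n)"
    by (auto simp: slice_def split: if_splits)
  moreover have "closed ((\<lambda>p'. p' $ n) -` ?F n)" for n
    by (intro closed_vimage continuous_intros compact_imp_closed F)
  ultimately have "closed (slice p)" by auto
  moreover have "bounded (slice p)"
  proof -
    have "\<forall>n. \<exists>b. \<forall>x\<in>?F n. norm x \<le> b" using F compact_imp_bounded bounded_iff by metis
    then obtain b where b: "\<And>n x. x \<in> ?F n \<Longrightarrow> norm x \<le> b n" by metis
    have "norm p' \<le> (\<Sum>n\<in>UNIV. b n)" if "p' \<in> slice p" for p'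
      using that by (intro norm_vec_le_sum[THEN order_trans] sum_mono b) (auto simp: slice_def)
    then show ?thesis by (auto simp: bounded_iff)
  qed
  ultimately show ?thesis by (simp add: compact_eq_bounded_closed)
qed

lemma convex_slice: "convex (slice p)"
proof (rule convexI)
  fix x y and a b :: real
  assume x: "x \<in> slice p" and y: "y \<in> slice p" and ab: "0 \<le> a" "0 \<le> b" "a + b = 1"
  have "a *\<^sub>R x $ n + b *\<^sub>R y $ n \<in> feasible_set S n" if "n \<in> cont_das S" for n
    using that x y ab by (intro convexD[OF convex_feasible_set_cont]) (auto simp: slice_def dest: spec[of _ n])
  moreover have "a *\<^sub>R x $ n + b *\<^sub>R y $ n = p $ n" if "n \<notin> cont_das S" for n
    using slice_disc[OF x that] slice_disc[OF y that] ab by (simp flip: scaleR_add_left)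
  ultimately show "a *\<^sub>R x + b *\<^sub>R y \<in> slice p" by (simp add: slice_def)
qed

lemma continuous_on_load: "continuous_on A load"
  unfolding load_def by (intro continuous_intros)

lemma load_diff: "load p - load p' = (\<Sum>n\<in>UNIV. (p - p') $ n)"
  by (simp add: load_def sum_subtractf)

lemma optimum:
  assumes "feasible S p"
  shows optimum_in_slice: "optimum p \<in> slice p"
    and level_le: "\<And>y. y \<in> slice p \<Longrightarrow> level p \<le> energy y"
proof -
  have "slice p \<noteq> {}" using self_in_slice[OF assms] by auto
  moreover have "continuous_on (slice p) energy"
    unfolding energy_def by (intro continuous_intros continuous_on_load)
  ultimately have "\<exists>x. x \<in> slice p \<and> (\<forall>y\<in>slice p. energy x \<le> energy y)"
    using continuous_attains_inf[OF compact_slice[of p]] by blast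
  from someI_ex[OF this] show "optimum p \<in> slice p" "\<And>y. y \<in> slice p \<Longrightarrow> level p \<le> energy y"
    by (auto simp: optimum_def level_def)
qed

lemma level_le_energy: "feasible S p \<Longrightarrow> level p \<le> energy p"
  by (simp add: level_le self_in_slice)

lemma level_nonneg: "level p \<ge> 0"
  by (simp add: level_def energy_def)

lemma finite_optima: "finite (optimum ` Collect (feasible S))"
proof -
  define G where "G c = optimum (\<chi> n. c n)" for c
  have "optimum p \<in> G ` (\<Pi>\<^sub>E n\<in>disc_das S. blocks S n)" if "feasible S p" for p
  proof (intro image_eqI[of _ _ "\<lambda>n\<in>disc_das S. p $ n"])
    show "optimum p = G (\<lambda>n\<in>disc_das S. p $ n)"
      unfolding G_def by (intro optimum_cong) simp
    show "(\<lambda>n\<in>disc_das S. p $ n) \<in> (\<Pi>\<^sub>E n\<in>disc_das S. blocks S n)"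
      using that by (auto simp: feasible_def feasible_set_disc_eq[symmetric])
  qed
  then have "optimum ` Collect (feasible S) \<subseteq> G ` (\<Pi>\<^sub>E n\<in>disc_das S. blocks S n)" by auto
  then show ?thesis by (rule finite_subset) (intro finite_imageI finite_PiE finite_blocks, simp)
qed

text \<open>The load of the optimum is the point nearest to 0 in the convex set of loads of the
  slice. Hence the angle at it is obtuse and Pythagoras holds as an inequality.\<close>

lemma energy_growth:
  assumes "feasible S p"
  shows "(norm (load p - load (optimum p)))\<^sup>2 \<le> energy p - level p"
proof -
  let ?x = "load (optimum p)"
  have "convex (load ` slice p)"
  proof (rule convexI, elim imageE, simp only:)
    fix x y and a b :: real
    assume "x \<in> slice p" "y \<in> slice p" and ab: "0 \<le> a" "0 \<le> b" "a + b = 1"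
    then have "a *\<^sub>R x + b *\<^sub>R y \<in> slice p" using convex_slice convexD by blast
    moreover have "a *\<^sub>R load x + b *\<^sub>R load y = (a + b) *\<^sub>R base S + (\<Sum>n\<in>UNIV. (a *\<^sub>R x + b *\<^sub>R y) $ n)"
      by (simp add: load_def algebra_simps sum.distrib scaleR_sum_right)
    ultimately show "a *\<^sub>R load x + b *\<^sub>R load y \<in> load ` slice p"
      using ab by (auto simp: load_def intro!: image_eqI[of _ _ "a *\<^sub>R x + b *\<^sub>R y"])
  qed
  moreover have "closed (load ` slice p)"
    by (intro compact_imp_closed compact_continuous_image continuous_on_load compact_slice)
  moreover have "dist 0 ?x \<le> dist 0 z" if "z \<in> load ` slice p" for z
    using that level_le[OF assms] by (auto simp: level_def energy_def dist_norm)
  ultimately have "(0 - ?x) \<bullet> (load p - ?x) \<le> 0"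
    using optimum_in_slice[OF assms] self_in_slice[OF assms]
    by (intro any_closest_point_dot[of "load ` slice p"]) auto
  moreover have "energy p = level p + 2 * (?x \<bullet> (load p - ?x)) + (norm (load p - ?x))\<^sup>2"
    unfolding energy_def level_def power2_norm_eq_inner
    by (simp add: algebra_simps inner_commute)
  ultimately show ?thesis by simp
qed

text \<open>The conformal bound is applied to the step from \<open>p\<close> to its optimum. The
  vector found there moves each coordinate between its values at these two profiles, so interval
  constraints survive, while equality of the images under \<open>L\<close> preserves the totals and
  reaches the optimal load. The point found may differ from \<open>optimum p\<close>.\<close>

lemma error_bound:
  obtains C where "C \<ge> 0"
    "\<And>p. feasible S p \<Longrightarrow>
       \<exists>x\<in>slice p. load x = load (optimum p) \<and> norm (x - p) \<le> C * norm (load p - load (optimum p))"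
proof -
  \<comment> \<open>The linear map records everything that has to be matched by equations: the total
    traffic of each application and the joint load. On the step considered the first part is 0, so
    its norm is the distance of the loads.\<close>
  define L where "L z = ((\<chi> n. \<Sum>t\<in>UNIV. z $ n $ t), (\<Sum>n\<in>UNIV. z $ n))" for z :: "('t, 'n) profile"
  have "linear L"
    by (rule linearI) (auto simp: L_def vec_eq_iff sum.distrib scaleR_sum_right sum_distrib_left)
  then have "bounded_linear L" by (simp add: linear_linear)
  then obtain C where C: "C \<ge> 0"
    "\<And>z. \<exists>w. (\<forall>i\<in>Basis. min 0 (z \<bullet> i) \<le> w \<bullet> i \<and> w \<bullet> i \<le> max 0 (z \<bullet> i)) \<and> L w = L z \<and>
         norm w \<le> C * norm (L z)"
    by (blast intro: conformal_error_bound)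
  show thesis
  proof (rule that[OF C(1)])
    fix p assume p: "feasible S p"
    define z where "z = optimum p - p"
    obtain w where w: "\<forall>i\<in>Basis. min 0 (z \<bullet> i) \<le> w \<bullet> i \<and> w \<bullet> i \<le> max 0 (z \<bullet> i)" "L w = L z"
      "norm w \<le> C * norm (L z)" using C(2) by blast
    have comp: "min 0 (z $ n $ t) \<le> w $ n $ t" "w $ n $ t \<le> max 0 (z $ n $ t)" for n t
    proof -
      have "axis n (axis t 1) \<in> (Basis :: ('t, 'n) profile set)" by (auto simp: Basis_vec_def)
      from bspec[OF w(1) this] show "min 0 (z $ n $ t) \<le> w $ n $ t" "w $ n $ t \<le> max 0 (z $ n $ t)"
        by (auto simp: inner_axis)
    qed
    have opt: "optimum p \<in> slice p" by (rule optimum_in_slice[OF p])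
    have L: "(\<Sum>t\<in>UNIV. w $ n $ t) = (\<Sum>t\<in>UNIV. z $ n $ t)" "(\<Sum>n\<in>UNIV. w $ n) = (\<Sum>n\<in>UNIV. z $ n)" for n
      using w(2) by (auto simp: L_def vec_eq_iff)
    have row: "(\<Sum>t\<in>UNIV. z $ n $ t) = 0" for n
    proof (cases "n \<in> cont_das S")
      case True
      then have "p $ n \<in> feasible_set S n" "optimum p $ n \<in> feasible_set S n"
        using p opt by (auto simp: feasible_def slice_def dest: spec[of _ n])
      then show ?thesis using True by (simp add: z_def feasible_set_def sum_subtractf)
    qed (use slice_disc[OF opt] in \<open>simp add: z_def\<close>)
    have "p + w \<in> slice p"
      unfolding slice_def
    proof (intro CollectI allI)
      fix n
      show "if n \<in> cont_das S then (p + w) $ n \<in> feasible_set S n else (p + w) $ n = p $ n"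
      proof (cases "n \<in> cont_das S")
        case True
        have pn: "p $ n \<in> feasible_set S n" "optimum p $ n \<in> feasible_set S n"
          using True p opt by (auto simp: feasible_def slice_def dest: spec[of _ n])
        have "lower S n $ t \<le> p $ n $ t + w $ n $ t \<and> p $ n $ t + w $ n $ t \<le> upper S n $ t" for t
        proof -
          have "lower S n $ t \<le> p $ n $ t" "p $ n $ t \<le> upper S n $ t"
            "lower S n $ t \<le> optimum p $ n $ t" "optimum p $ n $ t \<le> upper S n $ t"
            using pn True by (auto simp: feasible_set_def)
          then show ?thesis using comp[of n t] by (auto simp: z_def min_def max_def split: if_splits)
        qed
        moreover have "(\<Sum>t\<in>UNIV. p $ n $ t + w $ n $ t) = total S n"
          using pn True L(1)[of n] row[of n] by (simp add: sum.distrib feasible_set_def)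
        ultimately show ?thesis using True by (simp add: feasible_set_def)
      next
        case False
        have "w $ n $ t = 0" for t
          using comp[of n t] slice_disc[OF opt False] by (simp add: z_def)
        then show ?thesis using False by (simp add: vec_eq_iff)
      qed
    qed
    moreover have "load (p + w) = load (optimum p)"
      using L(2) by (simp add: load_def sum.distrib z_def sum_subtractf)
    moreover have "norm (L z) = norm (load p - load (optimum p))"
      using row by (simp add: L_def norm_Pair load_diff z_def norm_minus_commute zero_vec_def[symmetric]
         sum_subtractf)
    ultimately show "\<exists>x\<in>slice p. load x = load (optimum p) \<and> norm (x - p) \<le> C * norm (load p - load (optimum p))"
      using w(3) by (intro bexI[of _ "p + w"]) auto
  qed
qed

section \<open>Iterations in which no block changes\<close>

lemma no_switch_in_slice:
  "no_switch p \<in> slice p"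
  using mean_update_in_region[of p] by (auto simp: slice_def no_switch_def simp flip: region_cont)

lemma optimum_no_switch: "optimum (no_switch p) = optimum p"
  by (intro optimum_cong) (simp add: no_switch_def)

lemma level_no_switch: "level (no_switch p) = level p"
  by (simp add: level_def optimum_no_switch)

lemma feasible_no_switch: "feasible S p \<Longrightarrow> feasible S (no_switch p)"
  using no_switch_in_slice slice_feasible by blast

lemma norm_no_switch_le: "norm (no_switch p - p) \<le> norm (drift p)"
  by (intro norm_le_componentwise_cart) (auto simp: no_switch_def drift_def)

text \<open>Only continuous applications move here, so no variance enters and the full factor N is
  retained.\<close>

lemma energy_no_switch_le:
  assumes "feasible S p"
  shows "energy (no_switch p) \<le> energy p - real CARD('n) * (norm (no_switch p - p))\<^sup>2"
proof -
  let ?\<delta> = "\<lambda>n. (no_switch p - p) $ n"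
  have "energy (no_switch p) \<le> energy p + (\<Sum>n\<in>UNIV. 2 * (load p \<bullet> ?\<delta> n) + real CARD('n) * (norm (?\<delta> n))\<^sup>2)"
    using energy_add_le[of p "no_switch p - p"] by simp
  also have "\<dots> \<le> energy p + (\<Sum>n\<in>UNIV. - (real CARD('n) * (norm (?\<delta> n))\<^sup>2))"
  proof (intro add_left_mono sum_mono)
    fix n
    show "2 * (load p \<bullet> ?\<delta> n) + real CARD('n) * (norm (?\<delta> n))\<^sup>2 \<le> - (real CARD('n) * (norm (?\<delta> n))\<^sup>2)"
    proof (cases "n \<in> cont_das S")
      case True
      have "0 \<le> (real CARD('n) *\<^sub>R drift p $ n + load p) \<bullet> (p $ n - mean_update p $ n)"
        using True assms by (intro cont_variational feasible_in_region)
      then show ?thesis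
        using True by (simp add: no_switch_def drift_def power2_norm_eq_inner algebra_simps inner_commute)
    qed (simp add: no_switch_def)
  qed
  also have "\<dots> = energy p - real CARD('n) * (norm (no_switch p - p))\<^sup>2"
    unfolding norm_vec_squared[of "no_switch p - p"] sum_negf sum_distrib_left[symmetric] by simp
  finally show ?thesis .
qed

text \<open>After a projection step of length g, the optimality conditions hold up to an error of
  order g. Testing them at the nearby point of \<open>error_bound\<close> bounds the new excess by c
  g s, where s is the distance of the new load to the optimal one. Quadratic growth bounds s squared
  by the same excess, hence s is at most c g and the excess at most the square of c g.\<close>

lemma excess_no_switch_le:
  obtains K where "K > 0"
    "\<And>p. feasible S p \<Longrightarrow> energy (no_switch p) - level p \<le> K * (norm (no_switch p - p))\<^sup>2"
proof -
  obtain C where C: "C \<ge> 0"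
    "\<And>p. feasible S p \<Longrightarrow>
       \<exists>x\<in>slice p. load x = load (optimum p) \<and> norm (x - p) \<le> C * norm (load p - load (optimum p))"
    using error_bound by blast
  define N where "N = real CARD('n)"
  \<comment> \<open>The summand \<open>N\<close> comes from the variational inequality,
    \<open>N\<^sup>2\<close> from replacing \<open>load p\<close> by \<open>load p'\<close>, the
    factor 2 from the derivative of the square, and \<open>C\<close> from the error bound.\<close>
  define c where "c = 2 * (N + N\<^sup>2) * C"
  have N: "N \<ge> 0" by (simp add: N_def)
  have c: "c \<ge> 0" using C(1) N by (simp add: c_def)
  show thesis
  proof (rule that[of "c\<^sup>2 + 1"])
    show "c\<^sup>2 + 1 > 0" by (smt (verit) zero_le_power2)
    fix p assume p: "feasible S p"
    define p' where "p' = no_switch p"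
    define g where "g = norm (p' - p)"
    define s where "s = norm (load p' - load (optimum p))"
    have p': "feasible S p'" "optimum p' = optimum p" "level p' = level p"
      using p by (simp_all add: p'_def feasible_no_switch optimum_no_switch level_no_switch)
    obtain x where x: "x \<in> slice p'" "load x = load (optimum p)" "norm (x - p') \<le> C * s"
      using C(2)[OF p'(1)] by (auto simp: p' s_def)
    have "load p \<bullet> (p' - x) $ n \<le> N * ((p' - p) $ n \<bullet> (x - p') $ n)" for n
    proof (cases "n \<in> cont_das S")
      case True
      have "x $ n \<in> region n"
        using x(1) p'(1) slice_feasible feasible_in_region by blast
      then have "0 \<le> (real CARD('n) *\<^sub>R drift p $ n + load p) \<bullet> (x $ n - mean_update p $ n)"
        by (rule cont_variational[OF True])
      moreover have "mean_update p $ n = p' $ n" "drift p $ n = (p' - p) $ n"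
        using True by (simp_all add: p'_def no_switch_def drift_def)
      ultimately show ?thesis by (simp add: N_def inner_add_left inner_diff_right right_diff_distrib)
    next
      case False
      then show ?thesis using slice_disc[OF x(1) False] by simp
    qed
    then have "(\<Sum>n\<in>UNIV. load p \<bullet> (p' - x) $ n) \<le> (\<Sum>n\<in>UNIV. N * ((p' - p) $ n \<bullet> (x - p') $ n))"
      by (intro sum_mono)
    then have "load p \<bullet> (load p' - load x) \<le> N * ((p' - p) \<bullet> (x - p'))"
      unfolding load_diff inner_sum_right inner_vec_def[of "p' - p"] sum_distrib_left .
    also have "\<dots> \<le> N * (g * norm (x - p'))"
      unfolding g_def using N norm_cauchy_schwarz by (intro mult_left_mono) auto
    finally have 1: "load p \<bullet> (load p' - load x) \<le> N * (g * norm (x - p'))" .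
    have "(load p' - load p) \<bullet> (load p' - load x) \<le> norm (load p' - load p) * norm (load p' - load x)"
      by (rule norm_cauchy_schwarz)
    also have "\<dots> \<le> (N * g) * (N * norm (p' - x))"
      unfolding load_diff g_def N_def by (intro mult_mono norm_sum_components_le) auto
    finally have "load p' \<bullet> (load p' - load x) \<le> (N + N\<^sup>2) * (g * norm (x - p'))"
      using 1 by (simp add: inner_diff_left algebra_simps power2_eq_square norm_minus_commute)
    also have "\<dots> \<le> (N + N\<^sup>2) * (g * (C * s))"
      using x(3) N by (intro mult_left_mono) (auto simp: g_def)
    finally have "2 * (load p' \<bullet> (load p' - load x)) \<le> 2 * ((N + N\<^sup>2) * (g * (C * s)))"
      by linarith
    then have "2 * (load p' \<bullet> (load p' - load x)) \<le> c * g * s" by (simp add: c_def mult_ac)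
    moreover have "energy p' - level p = 2 * (load p' \<bullet> (load p' - load x)) - s\<^sup>2"
      unfolding energy_def level_def s_def x(2) power2_norm_eq_inner
      by (simp add: algebra_simps inner_commute)
    ultimately have 2: "energy p' - level p \<le> c * g * s" by (smt (verit) zero_le_power2)
    moreover have 3: "s\<^sup>2 \<le> energy p' - level p"
      using energy_growth[OF p'(1)] by (simp add: p' s_def)
    ultimately have "s * s \<le> (c * g) * s" by (simp add: power2_eq_square)
    then have "s \<le> c * g"
      using c by (cases "s = 0") (auto simp: g_def s_def mult_le_cancel_right)
    then have "c * g * s \<le> c * g * (c * g)" using c by (intro mult_left_mono) (auto simp: g_def)
    then have "energy p' - level p \<le> (c * g)\<^sup>2" using 2 by (simp add: power2_eq_square)
    also have "\<dots> \<le> (c\<^sup>2 + 1) * g\<^sup>2" by (simp add: power_mult_distrib algebra_simps)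
    finally show "energy (no_switch p) - level p \<le> (c\<^sup>2 + 1) * (norm (no_switch p - p))\<^sup>2"
      by (simp add: p'_def g_def)
  qed
qed

end

section \<open>Effect of switching blocks\<close>


lemma expectation_mono_pmf:
  fixes f g :: "'a \<Rightarrow> real"
  assumes "finite (set_pmf p)" "\<And>x. x \<in> set_pmf p \<Longrightarrow> f x \<le> g x"
  shows "measure_pmf.expectation p f \<le> measure_pmf.expectation p g"
  using assms by (intro integral_mono_AE integrable_measure_pmf_finite) (auto simp: AE_measure_pmf_iff)

lemma norm_squared_diff_le:
  fixes x y :: "'a::real_normed_vector"
  assumes "norm x \<le> b" "norm y \<le> b"
  shows "(norm x)\<^sup>2 - (norm y)\<^sup>2 \<le> 2 * b * norm (x - y)"
proof -
  have "(norm x)\<^sup>2 - (norm y)\<^sup>2 = (norm x - norm y) * (norm x + norm y)"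
    by (simp add: power2_eq_square algebra_simps)
  also have "\<dots> \<le> norm (x - y) * (2 * b)"
    using assms by (intro mult_mono norm_triangle_ineq2) auto
  finally show ?thesis by (simp add: mult_ac)
qed

context off_ds
begin

lemma norm_bounds:
  obtains B where "B > 0"
    "\<And>n x. x \<in> region n \<Longrightarrow> norm x \<le> B"
    "\<And>p. feasible S p \<Longrightarrow> norm (load p) \<le> B"
    "\<And>p. feasible S p \<Longrightarrow> norm (drift p) \<le> B"
proof -
  have "\<forall>n. \<exists>b. \<forall>x\<in>region n. norm x \<le> b"
    using compact_region compact_imp_bounded bounded_iff by metis
  then obtain b where b: "\<And>n x. x \<in> region n \<Longrightarrow> norm x \<le> b n" by metis
  have b0: "b n \<ge> 0" for n
    using region_nonempty[of n] b[of _ n] norm_ge_zero order_trans by (metis ex_in_conv)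
  define r where "r = (\<Sum>n\<in>UNIV. b n)"
  have "b n \<le> r" for n unfolding r_def using b0 by (intro member_le_sum) auto
  then have r: "norm x \<le> r" if "x \<in> region n" for n x using b[OF that] order_trans by blast
  have r0: "r \<ge> 0" unfolding r_def using b0 by (intro sum_nonneg) auto
  have N: "real CARD('n) \<ge> 2" by (rule card_ge_2)
  \<comment> \<open>Large enough for loads (base plus N r) and drifts (2 N r); the 1 makes it
    positive.\<close>
  define B where "B = norm (base S) + 2 * real CARD('n) * r + 1"
  have rB: "r \<le> B"
  proof -
    have "r * 1 \<le> r * (2 * real CARD('n))" using r0 N by (intro mult_left_mono) auto
    then have "r \<le> 2 * real CARD('n) * r" by (simp add: mult_ac)
    then show ?thesis unfolding B_def using norm_ge_zero[of "base S"] by linarith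
  qed
  show thesis
  proof
    show "B > 0" using r0 by (simp add: B_def add_nonneg_pos)
    show "norm x \<le> B" if "x \<in> region n" for n x using r[OF that] rB by simp
    fix p assume p: "feasible S p"
    have "norm (load p) \<le> norm (base S) + (\<Sum>n\<in>UNIV. norm (p $ n))"
      unfolding load_def by (intro norm_triangle_mono norm_sum order_refl)
    also have "\<dots> \<le> norm (base S) + (\<Sum>n\<in>(UNIV::'n set). r)"
      using feasible_in_region[OF p] by (intro add_left_mono sum_mono r) auto
    also have "\<dots> \<le> B" using r0 by (simp add: B_def)
    finally show "norm (load p) \<le> B" .
    have "norm (drift p) \<le> (\<Sum>n\<in>(UNIV::'n set). r + r)"
    proof (rule order_trans[OF norm_vec_le_sum], rule sum_mono)
      fix n
      have "norm (drift p $ n) \<le> norm (mean_update p $ n) + norm (p $ n)"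
        by (simp add: drift_def norm_triangle_ineq4)
      then show "norm (drift p $ n) \<le> r + r"
        using r[OF mean_update_in_region, of p n] r[OF feasible_in_region[OF p], of n] by linarith
    qed
    also have "\<dots> \<le> B" by (simp add: B_def)
    finally show "norm (drift p) \<le> B" .
  qed
qed

text \<open>Real-valued, so that sums count the changed applications and sums of products over
  distinct indices count ordered pairs of them.\<close>

definition switched :: "('t, 'n) profile \<Rightarrow> ('n \<Rightarrow> nat) \<Rightarrow> 'n \<Rightarrow> real" where
  "switched p a n = of_bool (block S n (a n) \<noteq> p $ n)"

text \<open>Between vectors f and p of equal norm the squared distance is -2 p\<bullet>(f - p),
  linear in f, so its mean is -2 p\<bullet>\<delta>. Distinct blocks have squared distance at least
  \<open>k\<close>, which turns this mean into a bound for the probability of a change.\<close>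

lemma expectation_switched_le:
  obtains c where "c > 0"
    "\<And>p n. feasible S p \<Longrightarrow> n \<notin> cont_das S \<Longrightarrow>
       measure_pmf.expectation (shift_weights S p n) (\<lambda>i. of_bool (block S n i \<noteq> p $ n)) \<le> c * norm (drift p $ n)"
proof -
  obtain B where B: "B > 0"
    "\<And>n x. x \<in> region n \<Longrightarrow> norm x \<le> B"
    "\<And>p. feasible S p \<Longrightarrow> norm (load p) \<le> B"
    "\<And>p. feasible S p \<Longrightarrow> norm (drift p) \<le> B"
    using norm_bounds by blast
  define D where "D = (\<Union>n. (\<lambda>(f, g). (norm (f - g))\<^sup>2) ` (blocks S n \<times> blocks S n))"
  have "finite D" by (simp add: D_def finite_blocks)
  then obtain k where k: "k > 0" "\<And>x. x \<in> D \<Longrightarrow> 0 < x \<Longrightarrow> k \<le> x"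
    using finite_pos_lower_bound by blast
  show thesis
  proof (rule that[of "2 / k * B"])
    show "2 / k * B > 0" using B k by simp
    fix p n assume p: "feasible S p" and n: "n \<notin> cont_das S"
    note fin = finite_shift_weights[OF n, of p]
    note int = integrable_measure_pmf_finite[OF fin]
    have pn: "p $ n \<in> feasible_set S n" using p by (simp add: feasible_def)
    have "measure_pmf.expectation (shift_weights S p n) (\<lambda>i. of_bool (block S n i \<noteq> p $ n)) \<le>
      measure_pmf.expectation (shift_weights S p n) (\<lambda>i. (- (2 / k) *\<^sub>R p $ n) \<bullet> (block S n i - p $ n))"
    proof (rule expectation_mono_pmf[OF fin])
      fix i assume "i \<in> set_pmf (shift_weights S p n)"
      then have i: "block S n i \<in> feasible_set S n" by (rule block_feasible[OF n])
      then have "norm (block S n i) = norm (p $ n)" using pn by (rule disc_norm_eq[OF n])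
      then have "block S n i \<bullet> block S n i = p $ n \<bullet> p $ n" by (metis power2_norm_eq_inner)
      then have eq: "(norm (block S n i - p $ n))\<^sup>2 = - 2 * (p $ n \<bullet> (block S n i - p $ n))"
        by (simp add: power2_norm_eq_inner algebra_simps inner_commute)
      have "of_bool (block S n i \<noteq> p $ n) \<le> (norm (block S n i - p $ n))\<^sup>2 / k"
      proof (cases "block S n i = p $ n")
        case False
        have "(norm (block S n i - p $ n))\<^sup>2 \<in> D"
          using i pn n by (auto simp: D_def feasible_set_disc_eq)
        then have "k \<le> (norm (block S n i - p $ n))\<^sup>2" using False by (intro k) auto
        then show ?thesis using False k by simp
      qed (use k in simp)
      then show "of_bool (block S n i \<noteq> p $ n) \<le> (- (2 / k) *\<^sub>R p $ n) \<bullet> (block S n i - p $ n)"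
        unfolding eq by simp
    qed
    also have "\<dots> = (- (2 / k) *\<^sub>R p $ n) \<bullet> drift p $ n"
      by (simp add: int expectation_shift_weights[OF n] drift_def)
    also have "\<dots> \<le> norm (- (2 / k) *\<^sub>R p $ n) * norm (drift p $ n)" by (rule norm_cauchy_schwarz)
    also have "\<dots> \<le> 2 / k * B * norm (drift p $ n)"
      using k B(2)[OF feasible_in_region[OF p], of n] by (intro mult_right_mono) (auto simp: divide_right_mono)
    finally show "measure_pmf.expectation (shift_weights S p n) (\<lambda>i. of_bool (block S n i \<noteq> p $ n)) \<le>
        2 / k * B * norm (drift p $ n)" .
  qed
qed

text \<open>A continuous application moves by its drift; a discrete one moves only when its block
  changes, and then by at most \<open>2 * B\<close>.\<close>

lemma expectation_displacement_le:
  obtains c where "c > 0"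
    "\<And>p. feasible S p \<Longrightarrow> measure_pmf.expectation (step S p) (\<lambda>p'. norm (p' - p)) \<le> c * norm (drift p)"
proof -
  obtain B where B: "B > 0"
    "\<And>n x. x \<in> region n \<Longrightarrow> norm x \<le> B"
    "\<And>p. feasible S p \<Longrightarrow> norm (load p) \<le> B"
    "\<And>p. feasible S p \<Longrightarrow> norm (drift p) \<le> B"
    using norm_bounds by blast
  obtain k where k: "k > 0"
    "\<And>p n. feasible S p \<Longrightarrow> n \<notin> cont_das S \<Longrightarrow>
       measure_pmf.expectation (shift_weights S p n) (\<lambda>i. of_bool (block S n i \<noteq> p $ n)) \<le> k * norm (drift p $ n)"
    using expectation_switched_le by blast
  let ?N = "real CARD('n)"
  show thesis
  proof (rule that[of "?N * (1 + 2 * B * k)"])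
    show "?N * (1 + 2 * B * k) > 0" using card_ge_2 B k by (intro mult_pos_pos add_pos_nonneg) auto
    fix p assume p: "feasible S p"
    let ?E = "measure_pmf.expectation (shift_choice p)"
    let ?s = "\<lambda>a n. if n \<in> cont_das S then norm (drift p $ n) else 2 * B * of_bool (block S n (a n) \<noteq> p $ n)"
    have "?E (\<lambda>a. norm (next_profile p a - p)) \<le> ?E (\<lambda>a. \<Sum>n\<in>UNIV. ?s a n)"
    proof (rule expectation_mono_pmf[OF finite_shift_choice])
      fix a assume a: "a \<in> set_pmf (shift_choice p)"
      show "norm (next_profile p a - p) \<le> (\<Sum>n\<in>UNIV. ?s a n)"
      proof (rule order_trans[OF norm_vec_le_sum], rule sum_mono)
        fix n
        show "norm ((next_profile p a - p) $ n) \<le> ?s a n"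
        proof (cases "n \<in> cont_das S")
          case False
          have "norm (next_profile p a $ n) \<le> B" "norm (p $ n) \<le> B"
            using feasible_in_region feasible_next_profile[OF a] p B(2) by blast+
          then show ?thesis
            using False norm_triangle_ineq4[of "next_profile p a $ n" "p $ n"] by (simp add: next_profile_def)
        qed (simp add: next_profile_def drift_def mean_update_def)
      qed
    qed
    also have "\<dots> = (\<Sum>n\<in>UNIV. ?E (\<lambda>a. ?s a n))" by simp
    also have "\<dots> \<le> (\<Sum>n\<in>(UNIV::'n set). (1 + 2 * B * k) * norm (drift p))"
    proof (rule sum_mono)
      fix n
      show "?E (\<lambda>a. ?s a n) \<le> (1 + 2 * B * k) * norm (drift p)"
      proof (cases "n \<in> cont_das S")
        case True
        have "1 * norm (drift p $ n) \<le> (1 + 2 * B * k) * norm (drift p)"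
          using B k by (intro mult_mono Finite_Cartesian_Product.norm_nth_le) auto
        then show ?thesis using True by simp
      next
        case False
        have "?E (\<lambda>a. ?s a n) = 2 * B * ?E (\<lambda>a. of_bool (block S n (a n) \<noteq> p $ n))"
          using False by simp
        also have "?E (\<lambda>a. of_bool (block S n (a n) \<noteq> p $ n)) \<le> k * norm (drift p $ n)"
          using k(2)[OF p False] expectation_shift_choice[OF False, of p "\<lambda>i. of_bool (block S n i \<noteq> p $ n) :: real"]
          by simp
        also have "\<dots> \<le> k * norm (drift p)"
          using k by (intro mult_left_mono Finite_Cartesian_Product.norm_nth_le) auto
        finally show ?thesis using B(1) by (simp add: algebra_simps add_increasing)
      qed
    qed
    finally show "measure_pmf.expectation (step S p) (\<lambda>p'. norm (p' - p)) \<le> ?N * (1 + 2 * B * k) * norm (drift p)"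
      by (simp add: step_eq)
  qed
qed

lemma equilibrium_if_no_drift:
  assumes "feasible S p" "drift p = 0"
  shows "equilibrium S p"
proof -
  obtain c where "measure_pmf.expectation (step S p) (\<lambda>p'. norm (p' - p)) \<le> c * norm (drift p)"
    using expectation_displacement_le assms(1) by metis
  moreover have "measure_pmf.expectation (step S p) (\<lambda>p'. norm (p' - p)) \<ge> 0"
    by (intro integral_nonneg_AE) auto
  ultimately have "measure_pmf.expectation (step S p) (\<lambda>p'. norm (p' - p)) = 0"
    using assms(2) by simp
  then have "AE p' in measure_pmf (step S p). norm (p' - p) = 0"
    by (subst (asm) integral_nonneg_eq_0_iff_AE) (auto intro: integrable_measure_pmf_finite finite_step)
  then show ?thesis using assms(1) by (simp add: equilibrium_def)
qed

text \<open>
  Blocks that are chosen with positive probability satisfy the optimality condition of the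
  relaxed problem with equality; to first order, switching to such a block leaves the energy unchanged.
\<close>

lemma disc_complementarity:
  assumes "n \<notin> cont_das S" "i \<in> set_pmf (shift_weights S p n)"
  shows "((real CARD('n) - 1) *\<^sub>R drift p $ n + load p - p $ n) \<bullet> (block S n i - mean_update p $ n) = 0"
proof -
  let ?h = "\<lambda>i. ((real CARD('n) - 1) *\<^sub>R drift p $ n + load p - p $ n) \<bullet> (block S n i - mean_update p $ n)"
  have nonneg: "?h j \<ge> 0" if "j \<in> set_pmf (shift_weights S p n)" for j
    using disc_variational[OF assms(1)] block_feasible[OF assms(1) that] feasible_set_subset_region by blast
  have "measure_pmf.expectation (shift_weights S p n) ?h = 0"
    by (rule expectation_inner_block[OF assms(1)])
  then have "AE j in measure_pmf (shift_weights S p n). ?h j = 0"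
    using nonneg by (subst (asm) integral_nonneg_eq_0_iff_AE)
      (auto simp: AE_measure_pmf_iff intro: integrable_measure_pmf_finite finite_shift_weights[OF assms(1)])
  then show ?thesis using assms(2) by (simp add: AE_measure_pmf_iff)
qed

lemma energy_single_switch_le:
  obtains c where "c > 0"
    "\<And>p n i. feasible S p \<Longrightarrow> n \<notin> cont_das S \<Longrightarrow> i \<in> set_pmf (shift_weights S p n) \<Longrightarrow>
       energy (\<chi> m. if m = n then block S n i else no_switch p $ m) \<le> energy p + c * norm (drift p)"
proof -
  obtain B where B: "B > 0"
    "\<And>n x. x \<in> region n \<Longrightarrow> norm x \<le> B"
    "\<And>p. feasible S p \<Longrightarrow> norm (load p) \<le> B"
    "\<And>p. feasible S p \<Longrightarrow> norm (drift p) \<le> B"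
    using norm_bounds by blast
  let ?N = "real CARD('n)"
  show thesis
  \<comment> \<open>Six of the ten parts come from the movement of the continuous applications; the
    other four bound the first-order terms of the switch, as 4 (N - 1) + 4 = 4 N.\<close>
  proof (rule that[of "10 * ?N * B"])
    show "10 * ?N * B > 0" using B card_ge_2 by simp
    fix p n i
    assume p: "feasible S p" and n: "n \<notin> cont_das S" and i: "i \<in> set_pmf (shift_weights S p n)"
    let ?f = "block S n i" and ?q = "mean_update p $ n" and ?\<delta> = "drift p $ n" and ?D = "load p"
    let ?p' = "\<chi> m. if m = n then ?f else no_switch p $ m"
    have f: "?f \<in> feasible_set S n" by (rule block_feasible[OF n i])
    have bds: "norm ?f \<le> B" "norm ?q \<le> B" "norm (p $ n) \<le> B" "norm ?D \<le> B" "norm (load (no_switch p)) \<le> B"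
      using f feasible_set_subset_region mean_update_in_region feasible_in_region[OF p] B p feasible_no_switch
      by blast+
    have \<delta>: "norm ?\<delta> \<le> norm (drift p)" by (rule Finite_Cartesian_Product.norm_nth_le)
    have "norm ?f = norm (p $ n)" using f p by (intro disc_norm_eq[OF n]) (auto simp: feasible_def)
    then have ff: "?f \<bullet> ?f = p $ n \<bullet> p $ n" by (metis power2_norm_eq_inner)
    have "no_switch p $ n = p $ n" using n by (simp add: no_switch_def)
    then have "?p' = no_switch p + axis n (?f - p $ n)"
      by (auto simp: vec_eq_iff axis_def)
    then have "load ?p' = load (no_switch p) + (\<Sum>m\<in>UNIV. axis n (?f - p $ n) $ m)"
      by (simp add: load_def sum.distrib)
    also have "(\<Sum>m\<in>UNIV. axis n (?f - p $ n) $ m) = ?f - p $ n"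
      by (simp add: axis_def sum.delta)
    finally have load': "load ?p' = load (no_switch p) + (?f - p $ n)" .
    have fp: "norm (?f - p $ n) \<le> 2 * B" using norm_triangle_ineq4[of ?f "p $ n"] bds by linarith
    \<comment> \<open>The continuous movement is removed first; both vectors compared have norm at
      most 3 B, a load plus a difference of two blocks.\<close>
    have "energy ?p' - (norm (?D + (?f - p $ n)))\<^sup>2 \<le>
        2 * (3 * B) * norm (load (no_switch p) + (?f - p $ n) - (?D + (?f - p $ n)))"
      unfolding energy_def load' using fp bds
      by (intro norm_squared_diff_le) (auto intro!: norm_triangle_le)
    also have "load (no_switch p) + (?f - p $ n) - (?D + (?f - p $ n)) = load (no_switch p) - ?D" by simp
    also have "norm (load (no_switch p) - ?D) \<le> ?N * norm (no_switch p - p)"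
      unfolding load_diff by (rule norm_sum_components_le)
    also have "\<dots> \<le> ?N * norm (drift p)" by (intro mult_left_mono norm_no_switch_le) auto
    finally have 1: "energy ?p' - (norm (?D + (?f - p $ n)))\<^sup>2 \<le> 6 * ?N * B * norm (drift p)"
      using B by (simp add: mult_ac)
    \<comment> \<open>By equality of norms the quadratic term of the switch is itself linear and
      turns the gradient into \<open>?D - p $ n\<close>, to which complementarity applies.\<close>
    have "(norm (?D + (?f - p $ n)))\<^sup>2 = energy p + 2 * ((?D - p $ n) \<bullet> (?f - p $ n))"
      unfolding energy_def power2_norm_eq_inner using ff
      by (simp add: algebra_simps inner_commute)
    also have "(?D - p $ n) \<bullet> (?f - p $ n) = (?D - p $ n) \<bullet> (?f - ?q) + (?D - p $ n) \<bullet> ?\<delta>"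
      by (simp add: drift_def algebra_simps)
    also have "(?D - p $ n) \<bullet> (?f - ?q) = - ((?N - 1) * (?\<delta> \<bullet> (?f - ?q)))"
      using disc_complementarity[OF n i] by (simp add: inner_add_left inner_diff_left)
    finally have 2: "(norm (?D + (?f - p $ n)))\<^sup>2 =
        energy p + 2 * (- ((?N - 1) * (?\<delta> \<bullet> (?f - ?q))) + (?D - p $ n) \<bullet> ?\<delta>)" .
    have "\<bar>?\<delta> \<bullet> (?f - ?q)\<bar> \<le> norm ?\<delta> * norm (?f - ?q)" by (rule Cauchy_Schwarz_ineq2)
    also have "\<dots> \<le> norm (drift p) * (2 * B)"
      using norm_triangle_ineq4[of ?f ?q] bds \<delta> by (intro mult_mono) auto
    finally have "(?N - 1) * \<bar>?\<delta> \<bullet> (?f - ?q)\<bar> \<le> (?N - 1) * (norm (drift p) * (2 * B))"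
      using card_ge_2 by (intro mult_left_mono) auto
    then have 3: "- ((?N - 1) * (?\<delta> \<bullet> (?f - ?q))) \<le> (?N - 1) * (norm (drift p) * (2 * B))"
      using card_ge_2 by (smt (verit) mult_minus_right mult_left_mono)
    have "(?D - p $ n) \<bullet> ?\<delta> \<le> norm (?D - p $ n) * norm ?\<delta>" by (rule norm_cauchy_schwarz)
    also have "\<dots> \<le> (2 * B) * norm (drift p)"
      using norm_triangle_ineq4[of ?D "p $ n"] bds \<delta> B(1) by (intro mult_mono) auto
    finally have 4: "(?D - p $ n) \<bullet> ?\<delta> \<le> (2 * B) * norm (drift p)" .
    have "e' \<le> e + 2 * (a + b) + c" if "e' - v \<le> c" "v = e + 2 * (x + y)" "x \<le> a" "y \<le> b"
      for e' e v x y a b c :: real using that by simp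
    from this[OF 1 2 3 4]
    have "energy ?p' \<le> energy p + 2 * ((?N - 1) * (norm (drift p) * (2 * B)) + (2 * B) * norm (drift p))
        + 6 * ?N * B * norm (drift p)" .
    then show "energy ?p' \<le> energy p + 10 * ?N * B * norm (drift p)"
      by (simp add: algebra_simps)
  qed
qed

section \<open>Contraction of the excess and its comparison with the drift\<close>

lemma energy_no_switch_ge: "feasible S p \<Longrightarrow> level p \<le> energy (no_switch p)"
  by (intro level_le no_switch_in_slice)

lemma norm_no_switch_squared_le:
  assumes "feasible S p"
  shows "(norm (no_switch p - p))\<^sup>2 \<le> energy p - level p"
proof -
  have "1 * (norm (no_switch p - p))\<^sup>2 \<le> real CARD('n) * (norm (no_switch p - p))\<^sup>2"
    using card_ge_2 by (intro mult_right_mono) auto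
  then show ?thesis using energy_no_switch_le[OF assms] energy_no_switch_ge[OF assms] by linarith
qed

text \<open>The new excess is at most K g squared, and the step of length g lowers the energy by at
  least N g squared; eliminating g gives the factor K/(K + N).\<close>

lemma excess_contraction:
  obtains \<rho> where "0 \<le> \<rho>" "\<rho> < 1"
    "\<And>p. feasible S p \<Longrightarrow> energy (no_switch p) - level p \<le> \<rho> * (energy p - level p)"
proof -
  obtain K where K: "K > 0"
    "\<And>p. feasible S p \<Longrightarrow> energy (no_switch p) - level p \<le> K * (norm (no_switch p - p))\<^sup>2"
    using excess_no_switch_le by blast
  let ?N = "real CARD('n)"
  have KN: "K + ?N > 0" using K card_ge_2 by simp
  show thesis
  proof (rule that[of "K / (K + ?N)"])
    show "0 \<le> K / (K + ?N)" "K / (K + ?N) < 1" using K card_ge_2 by auto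
    fix p assume p: "feasible S p"
    let ?e = "energy p - level p" and ?e' = "energy (no_switch p) - level p"
    have "?N * ?e' \<le> ?N * (K * (norm (no_switch p - p))\<^sup>2)" using K(2)[OF p] by (intro mult_left_mono) auto
    also have "\<dots> = K * (?N * (norm (no_switch p - p))\<^sup>2)" by simp
    also have "\<dots> \<le> K * (?e - ?e')"
      using K energy_no_switch_le[OF p] by (intro mult_left_mono) auto
    finally have "(K + ?N) * ?e' \<le> K * ?e" by (simp add: algebra_simps)
    then show "?e' \<le> K / (K + ?N) * ?e" using KN by (simp add: field_simps)
  qed
qed

text \<open>The part of the excess removed by one step without a change is Lipschitz in that step,
  and the part left over is quadratic in it. The result ensures that a single change costs only the
  square root of the drift in the square root of the excess.\<close>

lemma excess_le_drift:
  obtains c where "c > 0" "\<And>p. feasible S p \<Longrightarrow> energy p - level p \<le> c * norm (drift p)"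
proof -
  obtain B where B: "B > 0"
    "\<And>n x. x \<in> region n \<Longrightarrow> norm x \<le> B"
    "\<And>p. feasible S p \<Longrightarrow> norm (load p) \<le> B"
    "\<And>p. feasible S p \<Longrightarrow> norm (drift p) \<le> B"
    using norm_bounds by blast
  obtain K where K: "K > 0"
    "\<And>p. feasible S p \<Longrightarrow> energy (no_switch p) - level p \<le> K * (norm (no_switch p - p))\<^sup>2"
    using excess_no_switch_le by blast
  let ?N = "real CARD('n)"
  show thesis
  proof (rule that[of "2 * B * ?N + K * B"])
    show "2 * B * ?N + K * B > 0" using B K by (intro add_nonneg_pos) auto
    fix p assume p: "feasible S p"
    let ?g = "norm (no_switch p - p)"
    have g: "?g \<le> norm (drift p)" "?g \<le> B"
      using norm_no_switch_le[of p] B(4)[OF p] by linarith+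
    have "energy p - energy (no_switch p) \<le> 2 * B * norm (load p - load (no_switch p))"
      unfolding energy_def using p feasible_no_switch by (intro norm_squared_diff_le B(3)) auto
    also have "\<dots> \<le> 2 * B * (?N * norm (p - no_switch p))"
      using B(1) unfolding load_diff by (intro mult_left_mono norm_sum_components_le) auto
    also have "\<dots> \<le> 2 * B * (?N * norm (drift p))"
      using B(1) g by (intro mult_left_mono) (auto simp: norm_minus_commute)
    finally have 1: "energy p - energy (no_switch p) \<le> 2 * B * ?N * norm (drift p)" by simp
    have "?g\<^sup>2 \<le> B * norm (drift p)"
      unfolding power2_eq_square using g B(1) by (intro mult_mono) auto
    then have "K * ?g\<^sup>2 \<le> K * (B * norm (drift p))" using K(1) by simp
    then show "energy p - level p \<le> (2 * B * ?N + K * B) * norm (drift p)"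
      using 1 K(2)[OF p] by (simp add: algebra_simps)
  qed
qed

text \<open>The continuous part of the drift is bounded by the square root of the excess directly
  (\<open>norm_no_switch_squared_le\<close>); only this part needs a comparison with the
  optimum.\<close>

definition disc_drift :: "('t, 'n) profile \<Rightarrow> ('t, 'n) profile" where
  "disc_drift p = (\<chi> n. if n \<in> cont_das S then 0 else drift p $ n)"

text \<open>Both profiles have the same blocks, so the points projected differ only through the
  load. Projections are nonexpansive, and the loads are close by
  \<open>energy_growth\<close>.\<close>

lemma disc_drift_near_optimum:
  assumes "feasible S p"
  shows "norm (disc_drift p - disc_drift (optimum p)) \<le> real CARD('n) * sqrt (energy p - level p)"
proof -
  let ?o = "optimum p" and ?N = "real CARD('n)"
  have d: "norm (load p - load ?o) \<le> sqrt (energy p - level p)"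
    using energy_growth[OF assms] by (rule real_le_rsqrt)
  have "norm (disc_drift p - disc_drift ?o) \<le> (\<Sum>n\<in>(UNIV::'n set). sqrt (energy p - level p))"
  proof (rule order_trans[OF norm_vec_le_sum], rule sum_mono)
    fix n
    show "norm ((disc_drift p - disc_drift ?o) $ n) \<le> sqrt (energy p - level p)"
    proof (cases "n \<in> cont_das S")
      case True
      then show ?thesis using level_le_energy[OF assms] by (simp add: disc_drift_def)
    next
      case False
      have o: "?o $ n = p $ n" using slice_disc[OF optimum_in_slice[OF assms] False] .
      have "norm ((disc_drift p - disc_drift ?o) $ n) = dist (mean_update p $ n) (mean_update ?o $ n)"
        using False o by (simp add: disc_drift_def drift_def dist_norm)
      also have "\<dots> \<le> dist ((?N *\<^sub>R p $ n - load p) /\<^sub>R (?N - 1)) ((?N *\<^sub>R ?o $ n - load ?o) /\<^sub>R (?N - 1))"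
        unfolding mean_update_disc[OF False]
        by (intro closest_point_lipschitz convex_region closed_region region_nonempty)
      also have "\<dots> = norm (inverse (?N - 1) *\<^sub>R (load ?o - load p))"
        unfolding dist_norm o by (simp flip: scaleR_diff_right)
      also have "\<dots> = inverse (?N - 1) * norm (load p - load ?o)"
        using card_ge_2 by (simp add: norm_minus_commute)
      also have "\<dots> \<le> 1 * norm (load p - load ?o)"
        using card_ge_2 by (intro mult_right_mono) (auto simp: inverse_le_1_iff)
      finally show ?thesis using d by simp
    qed
  qed
  then show ?thesis by simp
qed

text \<open>
  There are finitely many optima.  If the optimum for the current blocks is not an equilibrium,
  then the drift is bounded away from zero near it.
\<close>

lemma drift_le_excess:
  obtains h where "h > 0"
    "\<And>p. feasible S p \<Longrightarrow> norm (drift p) + real CARD('n) * sqrt (energy p - level p) < h \<Longrightarrow>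
       norm (drift p) \<le> (real CARD('n) + 1) * sqrt (energy p - level p)"
proof -
  define A where "A = (\<lambda>p. norm (disc_drift p)) ` (optimum ` Collect (feasible S))"
  have "finite A" using finite_optima by (simp add: A_def)
  then obtain h where h: "h > 0" "\<And>x. x \<in> A \<Longrightarrow> 0 < x \<Longrightarrow> h \<le> x"
    using finite_pos_lower_bound by blast
  show thesis
  proof (rule that[OF h(1)])
    fix p assume p: "feasible S p"
      and small: "norm (drift p) + real CARD('n) * sqrt (energy p - level p) < h"
    note near = disc_drift_near_optimum[OF p]
    have "norm (disc_drift p) \<le> norm (drift p)"
      by (intro norm_le_componentwise_cart) (auto simp: disc_drift_def)
    then have "norm (disc_drift (optimum p)) < h"
      using near norm_triangle_ineq3[of "disc_drift (optimum p)" "disc_drift p"] small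
      by (simp add: norm_minus_commute)
    moreover have "norm (disc_drift (optimum p)) \<in> A" using p by (auto simp: A_def)
    \<comment> \<open>A norm from the finite set \<open>A\<close> that is below its least positive
      element must be 0.\<close>
    ultimately have "disc_drift (optimum p) = 0" using h(2) by (meson leD zero_less_norm_iff)
    then have 1: "norm (disc_drift p) \<le> real CARD('n) * sqrt (energy p - level p)" using near by simp
    have 2: "norm (no_switch p - p) \<le> sqrt (energy p - level p)"
      using norm_no_switch_squared_le[OF p] by (rule real_le_rsqrt)
    have "drift p = (no_switch p - p) + disc_drift p"
      by (auto simp: vec_eq_iff disc_drift_def no_switch_def drift_def)
    then have "norm (drift p) \<le> norm (no_switch p - p) + norm (disc_drift p)"
      by (metis norm_triangle_ineq)
    then show "norm (drift p) \<le> (real CARD('n) + 1) * sqrt (energy p - level p)"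
      using 1 2 by (simp add: algebra_simps)
  qed
qed

lemma level_gap:
  obtains g where "g > 0"
    "\<And>p p'. feasible S p \<Longrightarrow> feasible S p' \<Longrightarrow> level p < level p' \<Longrightarrow> level p + g \<le> level p'"
proof -
  define A where "A = energy ` (optimum ` Collect (feasible S))"
  define D where "D = (\<lambda>(x, y). y - x) ` (A \<times> A)"
  have "finite D" using finite_optima by (simp add: D_def A_def)
  then obtain g where g: "g > 0" "\<And>x. x \<in> D \<Longrightarrow> 0 < x \<Longrightarrow> g \<le> x"
    using finite_pos_lower_bound by blast
  show thesis
  proof (rule that[OF g(1)])
    fix p p' assume "feasible S p" "feasible S p'" "level p < level p'"
    moreover from this have "level p' - level p \<in> D" by (auto simp: D_def A_def level_def)
    ultimately show "level p + g \<le> level p'" using g(2)[of "level p' - level p"] by simp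
  qed
qed

end

section \<open>Almost sure convergence\<close>


context off_ds
begin

text \<open>The part of the Lyapunov function without the weighted energy, whose expected change is
  already known.\<close>

definition potential :: "real \<Rightarrow> ('t, 'n) profile \<Rightarrow> real" where
  "potential \<beta> p = \<beta> * level p + sqrt (energy p - level p)"

lemma potential_nonneg: "feasible S p \<Longrightarrow> \<beta> \<ge> 0 \<Longrightarrow> potential \<beta> p \<ge> 0"
  using level_le_energy[of p] level_nonneg[of p] by (simp add: potential_def)

lemma sqrt_excess_le: "sqrt (energy p - level p) \<le> norm (load p)"
  using level_nonneg[of p] by (intro real_le_lsqrt) (auto simp: energy_def)

lemma potential_le:
  assumes "feasible S p" "\<beta> \<ge> 0" "norm (load p) \<le> B"
  shows "potential \<beta> p \<le> \<beta> * B\<^sup>2 + B"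
proof -
  have "level p \<le> B\<^sup>2"
    using level_le_energy[OF assms(1)] power_mono[OF assms(3), of 2] by (simp add: energy_def)
  then have "\<beta> * level p \<le> \<beta> * B\<^sup>2" using assms(2) by (rule mult_left_mono)
  then show ?thesis using sqrt_excess_le[of p] assms(3) unfolding potential_def by linarith
qed

text \<open>
  A single switch hardly changes the energy, so it cannot lead to a higher level; a lower level
  more than makes up for any change of the square root.  Two simultaneous switches are only
  bounded crudely, since they have a probability of second order.
\<close>

lemma potential_next_le:
  assumes p: "feasible S p" and a: "a \<in> set_pmf (shift_choice p)"
    and gap: "\<And>p p'. feasible S p \<Longrightarrow> feasible S p' \<Longrightarrow> level p < level p' \<Longrightarrow> level p + g \<le> level p'"
    and \<beta>: "\<beta> \<ge> 0" "B \<le> \<beta> * g"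
    and B: "\<And>p. feasible S p \<Longrightarrow> norm (load p) \<le> B"
    and \<rho>: "0 \<le> \<rho>" "energy (no_switch p) - level p \<le> \<rho> * (energy p - level p)"
    and c: "0 \<le> c" "\<And>n i. n \<notin> cont_das S \<Longrightarrow> i \<in> set_pmf (shift_weights S p n) \<Longrightarrow>
       energy (\<chi> m. if m = n then block S n i else no_switch p $ m) \<le> energy p + c * norm (drift p)"
    and small: "energy p - level p + c * norm (drift p) < g"
  shows "potential \<beta> (next_profile p a) \<le> \<beta> * level p + sqrt (\<rho> * (energy p - level p)) +
    (\<Sum>n\<in>disc_das S. switched p a n) * sqrt (energy p - level p + c * norm (drift p)) +
    (\<Sum>n\<in>disc_das S. \<Sum>m\<in>disc_das S - {n}. switched p a n * switched p a m) * (\<beta> * B\<^sup>2 + B)"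
proof -
  let ?p = "next_profile p a" and ?e = "energy p - level p"
  let ?S1 = "\<Sum>n\<in>disc_das S. switched p a n"
  let ?S2 = "\<Sum>n\<in>disc_das S. \<Sum>m\<in>disc_das S - {n}. switched p a n * switched p a m"
  let ?r = "sqrt (?e + c * norm (drift p))" and ?M = "\<beta> * B\<^sup>2 + B"
  have e: "?e \<ge> 0" using level_le_energy[OF p] by simp
  have r: "?r \<ge> 0" using e c(1) by simp
  have B0: "B \<ge> 0" using B[OF p] norm_ge_zero order_trans by blast
  have M: "?M \<ge> 0" using \<beta> B0 by simp
  have s: "switched p a n \<ge> 0" for n by (simp add: switched_def)
  have S1: "?S1 \<ge> 0" by (intro sum_nonneg s)
  have S2: "?S2 \<ge> 0" by (intro sum_nonneg mult_nonneg_nonneg s)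
  have p': "feasible S ?p" by (rule feasible_next_profile[OF a])
  have \<rho>e: "sqrt (\<rho> * ?e) \<ge> 0" using e \<rho> by simp
  have lv: "\<beta> * level p \<ge> 0" using \<beta> level_nonneg by simp
  have S1r: "?S1 * ?r \<ge> 0" and S2M: "?S2 * ?M \<ge> 0"
    using S1 S2 r M by (auto intro: mult_nonneg_nonneg)
  consider (none) "\<forall>n\<in>disc_das S. block S n (a n) = p $ n"
    | (one) n where "n \<in> disc_das S" "block S n (a n) \<noteq> p $ n" "\<forall>m\<in>disc_das S. m \<noteq> n \<longrightarrow> block S m (a m) = p $ m"
    | (two) n m where "n \<in> disc_das S" "m \<in> disc_das S" "n \<noteq> m" "block S n (a n) \<noteq> p $ n" "block S m (a m) \<noteq> p $ m"
    by blast
  then show ?thesis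
  proof cases
    case none
    then have "?p = no_switch p"
      by (auto simp: vec_eq_iff next_profile_def no_switch_def mean_update_def)
    then have "potential \<beta> ?p \<le> \<beta> * level p + sqrt (\<rho> * ?e)"
      using \<rho>(2) by (simp add: potential_def level_no_switch)
    then show ?thesis using S1r S2M by linarith
  next
    case one
    have n: "n \<notin> cont_das S" using one(1) by simp
    have "?p = (\<chi> m. if m = n then block S n (a n) else no_switch p $ m)"
      using one by (auto simp: vec_eq_iff next_profile_def no_switch_def mean_update_def)
    then have en: "energy ?p \<le> energy p + c * norm (drift p)"
      using c(2)[OF n shift_choice_in[OF a n]] by simp
    have "\<not> level p < level ?p"
    proof
      assume "level p < level ?p"
      then have "level p + g \<le> energy ?p" using gap[OF p p'] level_le_energy[OF p'] by linarith
      then show False using en small by linarith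
    qed
    then consider "level ?p = level p" | "level ?p < level p" by linarith
    then have "potential \<beta> ?p \<le> \<beta> * level p + ?r"
    proof cases
      case 1
      then show ?thesis using en by (simp add: potential_def)
    next
      case 2
      \<comment> \<open>The level falls by at least \<open>g\<close>, and
        \<open>\<beta> * g \<ge> B\<close> covers the largest possible square root of the new
        excess.\<close>
      then have "\<beta> * (level ?p + g) \<le> \<beta> * level p" using gap[OF p' p] \<beta> by (intro mult_left_mono) auto
      then have "potential \<beta> ?p \<le> \<beta> * level p"
        using sqrt_excess_le[of ?p] B[OF p'] \<beta>(2) by (simp add: potential_def distrib_left)
      then show ?thesis using r by linarith
    qed
    moreover have "1 * ?r \<le> ?S1 * ?r"
    proof (intro mult_right_mono r)
      have "switched p a n \<le> ?S1" using one(1) s by (intro member_le_sum) auto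
      then show "1 \<le> ?S1" using one(2) by (simp add: switched_def)
    qed
    ultimately show ?thesis using \<rho>e S2M by linarith
  next
    case two
    have "potential \<beta> ?p \<le> 1 * ?M" using potential_le[OF p' \<beta>(1) B[OF p']] by simp
    also have "\<dots> \<le> ?S2 * ?M"
    proof (intro mult_right_mono M)
      have "switched p a n * switched p a m \<le> (\<Sum>m\<in>disc_das S - {n}. switched p a n * switched p a m)"
        using two s by (intro member_le_sum) auto
      also have "\<dots> \<le> ?S2"
        using two s by (intro member_le_sum[of n "disc_das S" "\<lambda>n. \<Sum>m\<in>disc_das S - {n}. switched p a n * switched p a m"])
          (auto intro!: sum_nonneg)
      finally show "1 \<le> ?S2" using two by (simp add: switched_def)
    qed
    finally show ?thesis using lv \<rho>e S1r by linarith
  qed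
qed

text \<open>The pathwise bound is averaged. Each single indicator has mean at most
  \<open>k * norm (drift p)\<close>; by independence a product of two has mean at most the square of
  that, which leaves the crude bound with a second-order weight.\<close>

lemma expectation_potential_le:
  assumes p: "feasible S p"
    and gap: "\<And>p p'. feasible S p \<Longrightarrow> feasible S p' \<Longrightarrow> level p < level p' \<Longrightarrow> level p + g \<le> level p'"
    and \<beta>: "\<beta> \<ge> 0" "B \<le> \<beta> * g"
    and B: "\<And>p. feasible S p \<Longrightarrow> norm (load p) \<le> B"
    and \<rho>: "0 \<le> \<rho>" "energy (no_switch p) - level p \<le> \<rho> * (energy p - level p)"
    and c: "0 \<le> c" "\<And>n i. n \<notin> cont_das S \<Longrightarrow> i \<in> set_pmf (shift_weights S p n) \<Longrightarrow>
       energy (\<chi> m. if m = n then block S n i else no_switch p $ m) \<le> energy p + c * norm (drift p)"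
    and small: "energy p - level p + c * norm (drift p) < g"
    and k: "0 \<le> k" "\<And>n. n \<notin> cont_das S \<Longrightarrow>
       measure_pmf.expectation (shift_weights S p n) (\<lambda>i. of_bool (block S n i \<noteq> p $ n)) \<le> k * norm (drift p $ n)"
  shows "measure_pmf.expectation (step S p) (potential \<beta>) \<le> \<beta> * level p + sqrt (\<rho> * (energy p - level p)) +
    real CARD('n) * k * norm (drift p) * sqrt (energy p - level p + c * norm (drift p)) +
    (real CARD('n) * k * norm (drift p))\<^sup>2 * (\<beta> * B\<^sup>2 + B)"
proof -
  let ?E = "measure_pmf.expectation (shift_choice p)"
  let ?r = "sqrt (energy p - level p + c * norm (drift p))" and ?M = "\<beta> * B\<^sup>2 + B"
  let ?d = "k * norm (drift p)" and ?N = "real CARD('n)"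
  have r: "?r \<ge> 0" using level_le_energy[OF p] c(1) by simp
  have M: "?M \<ge> 0" using \<beta>(1) order_trans[OF norm_ge_zero B[OF p]] by simp
  have d: "?d \<ge> 0" using k(1) by simp
  have cardN: "real (card (disc_das S)) \<le> ?N"
    by (intro of_nat_mono card_mono) auto
  have sw: "?E (\<lambda>a. switched p a n) \<le> ?d"
    and sw_eq: "?E (\<lambda>a. switched p a n) =
      measure_pmf.expectation (shift_weights S p n) (\<lambda>i. of_bool (block S n i \<noteq> p $ n))"
    if n: "n \<in> disc_das S" for n
  proof -
    have nc: "n \<notin> cont_das S" using n by simp
    show eq: "?E (\<lambda>a. switched p a n) =
      measure_pmf.expectation (shift_weights S p n) (\<lambda>i. of_bool (block S n i \<noteq> p $ n))"
      unfolding switched_def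
      using expectation_shift_choice[OF nc, of p "\<lambda>i. of_bool (block S n i \<noteq> p $ n) :: real"] by simp
    have "k * norm (drift p $ n) \<le> ?d"
      using k(1) by (intro mult_left_mono Finite_Cartesian_Product.norm_nth_le)
    then show "?E (\<lambda>a. switched p a n) \<le> ?d" using k(2)[OF nc] eq by linarith
  qed
  have sw0: "?E (\<lambda>a. switched p a n) \<ge> 0" for n
    by (intro integral_nonneg_AE) (simp add: switched_def)
  have sw2: "?E (\<lambda>a. switched p a n * switched p a m) \<le> ?d * ?d"
    if n: "n \<in> disc_das S" and m: "m \<in> disc_das S - {n}" for n m
  proof -
    have "?E (\<lambda>a. switched p a n * switched p a m) = ?E (\<lambda>a. switched p a n) * ?E (\<lambda>a. switched p a m)"
      using n m expectation_shift_choice_mult[of n m p "\<lambda>i. of_bool (block S n i \<noteq> p $ n)" "\<lambda>i. of_bool (block S m i \<noteq> p $ m)"]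
      by (subst (1 2) sw_eq) (auto simp: switched_def)
    also have "\<dots> \<le> ?d * ?d" using n m by (intro mult_mono sw sw0 d) auto
    finally show ?thesis .
  qed
  have "measure_pmf.expectation (step S p) (potential \<beta>) = ?E (\<lambda>a. potential \<beta> (next_profile p a))"
    by (simp add: step_eq)
  also have "\<dots> \<le> ?E (\<lambda>a. \<beta> * level p + sqrt (\<rho> * (energy p - level p)) +
    (\<Sum>n\<in>disc_das S. switched p a n) * ?r +
    (\<Sum>n\<in>disc_das S. \<Sum>m\<in>disc_das S - {n}. switched p a n * switched p a m) * ?M)"
    by (intro expectation_mono_pmf[OF finite_shift_choice] potential_next_le[OF p _ gap \<beta> B \<rho> c small])
  also have "\<dots> = \<beta> * level p + sqrt (\<rho> * (energy p - level p)) +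
    (\<Sum>n\<in>disc_das S. ?E (\<lambda>a. switched p a n)) * ?r +
    (\<Sum>n\<in>disc_das S. \<Sum>m\<in>disc_das S - {n}. ?E (\<lambda>a. switched p a n * switched p a m)) * ?M"
    by simp
  also have "\<dots> \<le> \<beta> * level p + sqrt (\<rho> * (energy p - level p)) + (?N * ?d) * ?r + (?N * ?d)\<^sup>2 * ?M"
  proof (intro add_mono mult_right_mono r M order_refl)
    have "(\<Sum>n\<in>disc_das S. ?E (\<lambda>a. switched p a n)) \<le> (\<Sum>n\<in>disc_das S. ?d)"
      by (intro sum_mono sw)
    also have "\<dots> \<le> ?N * ?d" using mult_right_mono[OF cardN d] by simp
    finally show "(\<Sum>n\<in>disc_das S. ?E (\<lambda>a. switched p a n)) \<le> ?N * ?d" .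
    have "(\<Sum>n\<in>disc_das S. \<Sum>m\<in>disc_das S - {n}. ?E (\<lambda>a. switched p a n * switched p a m)) \<le>
        (\<Sum>n\<in>disc_das S. ?N * (?d * ?d))"
    proof (intro sum_mono)
      fix n assume n: "n \<in> disc_das S"
      have "(\<Sum>m\<in>disc_das S - {n}. ?E (\<lambda>a. switched p a n * switched p a m)) \<le> (\<Sum>m\<in>disc_das S - {n}. ?d * ?d)"
        by (intro sum_mono sw2 n)
      also have "\<dots> = real (card (disc_das S - {n})) * (?d * ?d)" by simp
      also have "\<dots> \<le> ?N * (?d * ?d)"
        using d by (intro mult_right_mono of_nat_mono card_mono) auto
      finally show "(\<Sum>m\<in>disc_das S - {n}. ?E (\<lambda>a. switched p a n * switched p a m)) \<le> ?N * (?d * ?d)" .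
    qed
    also have "\<dots> = real (card (disc_das S)) * (?N * (?d * ?d))" by simp
    also have "\<dots> \<le> ?N * (?N * (?d * ?d))" by (intro mult_right_mono cardN) auto
    also have "\<dots> = (?N * ?d)\<^sup>2" by (simp add: power2_eq_square mult_ac)
    finally show "(\<Sum>n\<in>disc_das S. \<Sum>m\<in>disc_das S - {n}. ?E (\<lambda>a. switched p a n * switched p a m)) \<le> (?N * ?d)\<^sup>2" .
  qed (simp_all add: level_nonneg)
  finally show ?thesis by (simp add: mult_ac)
qed

lemma lyapunov:
  obtains \<Phi> :: "('t, 'n) profile \<Rightarrow> real" and c :: real where "c > 0"
    "\<And>p. feasible S p \<Longrightarrow> \<Phi> p \<ge> 0"
    "\<And>p. feasible S p \<Longrightarrow> measure_pmf.expectation (step S p) \<Phi> \<le> \<Phi> p - c * norm (drift p)"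
proof -
  define N where "N = real CARD('n)"
  have N: "N \<ge> 2" unfolding N_def by (rule card_ge_2)
  obtain B where B: "B > 0"
    "\<And>n x. x \<in> region n \<Longrightarrow> norm x \<le> B"
    "\<And>p. feasible S p \<Longrightarrow> norm (load p) \<le> B"
    "\<And>p. feasible S p \<Longrightarrow> norm (drift p) \<le> B"
    using norm_bounds by blast
  obtain g where g: "g > 0"
    "\<And>p p'. feasible S p \<Longrightarrow> feasible S p' \<Longrightarrow> level p < level p' \<Longrightarrow> level p + g \<le> level p'"
    using level_gap by blast
  obtain \<rho> where \<rho>: "0 \<le> \<rho>" "\<rho> < 1"
    "\<And>p. feasible S p \<Longrightarrow> energy (no_switch p) - level p \<le> \<rho> * (energy p - level p)"
    using excess_contraction by blast
  obtain c where c: "c > 0"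
    "\<And>p n i. feasible S p \<Longrightarrow> n \<notin> cont_das S \<Longrightarrow> i \<in> set_pmf (shift_weights S p n) \<Longrightarrow>
       energy (\<chi> m. if m = n then block S n i else no_switch p $ m) \<le> energy p + c * norm (drift p)"
    using energy_single_switch_le by blast
  obtain k where k: "k > 0"
    "\<And>p n. feasible S p \<Longrightarrow> n \<notin> cont_das S \<Longrightarrow>
       measure_pmf.expectation (shift_weights S p n) (\<lambda>i. of_bool (block S n i \<noteq> p $ n)) \<le> k * norm (drift p $ n)"
    using expectation_switched_le by blast
  obtain K where K: "K > 0" "\<And>p. feasible S p \<Longrightarrow> energy p - level p \<le> K * norm (drift p)"
    using excess_le_drift by blast
  obtain h where h: "h > 0"
    "\<And>p. feasible S p \<Longrightarrow> norm (drift p) + real CARD('n) * sqrt (energy p - level p) < h \<Longrightarrow>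
       norm (drift p) \<le> (real CARD('n) + 1) * sqrt (energy p - level p)"
    using drift_le_excess by blast
  define \<beta> where "\<beta> = B / g"
  have \<beta>: "\<beta> \<ge> 0" "B \<le> \<beta> * g" using B(1) g(1) by (simp_all add: \<beta>_def)
  define M where "M = \<beta> * B\<^sup>2 + B"
  have M: "M > 0" using \<beta> B(1) by (simp add: M_def add_nonneg_pos)
  \<comment> \<open>Half of the relative gain \<open>1 - sqrt \<rho>\<close>: one half absorbs the
    cost of changes, the other remains as decrease.\<close>
  define s where "s = (1 - sqrt \<rho>) / 2"
  have s: "s > 0" using \<rho> by (simp add: s_def)
  \<comment> \<open>Threshold between small and large drift. The conditions make
    \<open>drift_le_excess\<close> applicable, keep a single change from reaching a higher level,
    and bound the cost of all changes by \<open>s\<close> times the square root of the excess. Each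
    left-hand side tends to 0 with \<eta>.\<close>
  have "\<exists>\<eta>>0. \<eta> + N * sqrt (K * \<eta>) < h \<and> (K + c) * \<eta> < g \<and>
      N * k * (N + 1) * sqrt ((K + c) * \<eta>) + (N * k)\<^sup>2 * (N + 1) * M * \<eta> < s"
  proof -
    have "((\<lambda>\<eta>. \<eta> + N * sqrt (K * \<eta>)) \<longlongrightarrow> 0 + N * sqrt (K * 0)) (at_right 0)"
      "((\<lambda>\<eta>. (K + c) * \<eta>) \<longlongrightarrow> (K + c) * 0) (at_right 0)"
      "((\<lambda>\<eta>. N * k * (N + 1) * sqrt ((K + c) * \<eta>) + (N * k)\<^sup>2 * (N + 1) * M * \<eta>) \<longlongrightarrow>
        N * k * (N + 1) * sqrt ((K + c) * 0) + (N * k)\<^sup>2 * (N + 1) * M * 0) (at_right 0)"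
      by (intro tendsto_intros)+
    then have "\<forall>\<^sub>F \<eta> in at_right 0. \<eta> + N * sqrt (K * \<eta>) < h" "\<forall>\<^sub>F \<eta> in at_right 0. (K + c) * \<eta> < g"
      "\<forall>\<^sub>F \<eta> in at_right 0. N * k * (N + 1) * sqrt ((K + c) * \<eta>) + (N * k)\<^sup>2 * (N + 1) * M * \<eta> < s"
      using h(1) g(1) s by (auto dest: order_tendstoD(2))
    moreover have "\<forall>\<^sub>F \<eta> in at_right (0::real). 0 < \<eta>" by (rule eventually_at_right_less)
    ultimately have "\<forall>\<^sub>F \<eta> in at_right 0. 0 < \<eta> \<and> \<eta> + N * sqrt (K * \<eta>) < h \<and> (K + c) * \<eta> < g \<and>
        N * k * (N + 1) * sqrt ((K + c) * \<eta>) + (N * k)\<^sup>2 * (N + 1) * M * \<eta> < s"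
      by (intro eventually_conj)
    then show ?thesis using eventually_happens'[OF trivial_limit_at_right_real] by blast
  qed
  then obtain \<eta> where \<eta>: "\<eta> > 0" "\<eta> + N * sqrt (K * \<eta>) < h" "(K + c) * \<eta> < g"
    "N * k * (N + 1) * sqrt ((K + c) * \<eta>) + (N * k)\<^sup>2 * (N + 1) * M * \<eta> < s" by blast
  \<comment> \<open>Chosen so that \<open>A * d\<^sup>2\<close> exceeds \<open>d + M\<close> once
    \<open>d \<ge> \<eta>\<close>; there the potential is merely bounded by
    \<open>M\<close>.\<close>
  define A where "A = 2 / \<eta> + 2 * M / \<eta>\<^sup>2"
  have A: "A \<ge> 0" using \<eta>(1) M by (simp add: A_def)
  \<comment> \<open>The value 1 serves the case of large drift, the other that of small drift, where
    \<open>d \<le> (N + 1) * sqrt e\<close>.\<close>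
  define c' where "c' = min 1 (s / (N + 1))"
  have c': "c' > 0" "c' \<le> 1" "c' \<le> s / (N + 1)" using s N by (simp_all add: c'_def)
  define \<Phi> where "\<Phi> p = A * energy p + potential \<beta> p" for p
  show thesis
  proof (rule that[of c' \<Phi>, OF c'(1)])
    fix p assume p: "feasible S p"
    show "\<Phi> p \<ge> 0" using A potential_nonneg[OF p \<beta>(1)] by (simp add: \<Phi>_def energy_def)
    note int = integrable_measure_pmf_finite[OF finite_step[of p]]
    define d where "d = norm (drift p)"
    define e where "e = energy p - level p"
    have d0: "d \<ge> 0" by (simp add: d_def)
    have e0: "e \<ge> 0" using level_le_energy[OF p] by (simp add: e_def)
    have split: "measure_pmf.expectation (step S p) \<Phi> =
        A * measure_pmf.expectation (step S p) energy + measure_pmf.expectation (step S p) (potential \<beta>)"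
      by (simp add: \<Phi>_def[abs_def] int)
    have "measure_pmf.expectation (step S p) energy \<le> energy p - (N - 1) * d\<^sup>2"
      using energy_decreases[OF p] by (simp add: N_def d_def)
    also have "\<dots> \<le> energy p - d\<^sup>2"
      using mult_right_mono[of 1 "N - 1" "d\<^sup>2"] N by simp
    finally have en: "A * measure_pmf.expectation (step S p) energy \<le> A * energy p - A * d\<^sup>2"
      using mult_left_mono[OF _ A] by (fastforce simp: right_diff_distrib)
    show "measure_pmf.expectation (step S p) \<Phi> \<le> \<Phi> p - c' * norm (drift p)"
    proof (cases "d < \<eta>")
      case False
      then have d\<eta>: "\<eta> \<le> d" by simp
      have "measure_pmf.expectation (step S p) (potential \<beta>) \<le> measure_pmf.expectation (step S p) (\<lambda>_. M)"
        unfolding M_def by (intro expectation_mono_pmf finite_step potential_le \<beta>(1) B(3)) (auto dest: feasible_step)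
      then have pot: "measure_pmf.expectation (step S p) (potential \<beta>) \<le> M" by simp
      have "1 \<le> d / \<eta>" using d\<eta> \<eta>(1) by simp
      then have "d * 1 \<le> d * (d / \<eta>)" using d0 by (intro mult_left_mono)
      moreover have "M * 1 \<le> M * (d / \<eta>)\<^sup>2"
        using \<open>1 \<le> d / \<eta>\<close> M by (intro mult_left_mono one_le_power) auto
      moreover have "A * d\<^sup>2 = 2 * (d * (d / \<eta>)) + 2 * (M * (d / \<eta>)\<^sup>2)"
        by (simp add: A_def distrib_right power2_eq_square)
      ultimately have "d + M \<le> A * d\<^sup>2" using d0 M by linarith
      moreover have "c' * d \<le> 1 * d" using c' d0 by (intro mult_right_mono)
      moreover have "potential \<beta> p \<ge> 0" by (rule potential_nonneg[OF p \<beta>(1)])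
      ultimately show ?thesis using en pot unfolding split \<Phi>_def d_def by linarith
    next
      case True
      have eK: "e \<le> K * \<eta>"
        using K(2)[OF p] mult_left_mono[of d \<eta> K] True K(1) unfolding e_def d_def by linarith
      have "sqrt e \<le> sqrt (K * \<eta>)" using eK by simp
      then have "d + N * sqrt e < h"
        using True \<eta>(2) mult_left_mono[of "sqrt e" "sqrt (K * \<eta>)" N] N by linarith
      then have de: "d \<le> (N + 1) * sqrt e" using h(2)[OF p] by (simp add: d_def e_def N_def)
      have cd: "c * d \<le> c * \<eta>" using True c(1) by simp
      have ecd: "e + c * d \<le> (K + c) * \<eta>" using eK cd by (simp add: distrib_right)
      have "measure_pmf.expectation (step S p) (potential \<beta>) \<le>
          \<beta> * level p + sqrt (\<rho> * e) + N * k * d * sqrt (e + c * d) + (N * k * d)\<^sup>2 * M"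
        unfolding d_def e_def N_def M_def
      proof (rule expectation_potential_le[OF p g(2) \<beta> B(3) \<rho>(1) \<rho>(3)[OF p] _ c(2)[OF p] _ _ k(2)[OF p]])
        show "energy p - level p + c * norm (drift p) < g" using ecd \<eta>(3) by (simp add: d_def e_def)
      qed (use c(1) k(1) in auto)
      also have "sqrt (\<rho> * e) = (1 - 2 * s) * sqrt e" by (simp add: s_def real_sqrt_mult field_simps)
      \<comment> \<open>One factor \<open>d\<close> is traded for \<open>sqrt e\<close>, while the
        rest is bounded through \<eta>; the cost thus becomes a small multiple of the gain from
        contraction. The quadratic term is treated alike.\<close>
      also have "N * k * d * sqrt (e + c * d) \<le> N * k * ((N + 1) * sqrt e) * sqrt ((K + c) * \<eta>)"
        using ecd de N k(1) e0 c(1) d0 by (intro mult_mono) auto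
      also have "(N * k * d)\<^sup>2 * M \<le> (N * k)\<^sup>2 * (\<eta> * ((N + 1) * sqrt e)) * M"
      proof -
        have "d\<^sup>2 \<le> \<eta> * ((N + 1) * sqrt e)"
          unfolding power2_eq_square using True de d0 \<eta>(1) by (intro mult_mono) auto
        then have "(N * k)\<^sup>2 * d\<^sup>2 * M \<le> (N * k)\<^sup>2 * (\<eta> * ((N + 1) * sqrt e)) * M"
          using M by (intro mult_right_mono mult_left_mono) auto
        then show ?thesis by (simp add: power_mult_distrib)
      qed
      finally have "measure_pmf.expectation (step S p) (potential \<beta>) \<le> \<beta> * level p + (1 - 2 * s) * sqrt e +
          (N * k * (N + 1) * sqrt ((K + c) * \<eta>) + (N * k)\<^sup>2 * (N + 1) * M * \<eta>) * sqrt e"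
        by (simp add: algebra_simps)
      also have "\<dots> \<le> \<beta> * level p + (1 - 2 * s) * sqrt e + s * sqrt e"
        using \<eta>(4) e0 by (intro add_left_mono mult_right_mono) auto
      also have "\<dots> = potential \<beta> p - s * sqrt e"
        by (simp add: potential_def e_def algebra_simps)
      also have "c' * d \<le> s * sqrt e"
      proof -
        have "c' * d \<le> s / (N + 1) * ((N + 1) * sqrt e)"
          using c' de d0 s N by (intro mult_mono) auto
        then show ?thesis using N by simp
      qed
      then have "potential \<beta> p - s * sqrt e \<le> potential \<beta> p - c' * d" by simp
      finally have "measure_pmf.expectation (step S p) (potential \<beta>) \<le> potential \<beta> p - c' * d" .
      moreover have "A * d\<^sup>2 \<ge> 0" using A by simp
      ultimately show ?thesis using en unfolding split \<Phi>_def d_def by linarith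
    qed
  qed
qed

lemma closed_feasible: "closed (Collect (feasible S))"
proof -
  have "Collect (feasible S) = (\<Inter>n. (\<lambda>p. p $ n) -` feasible_set S n)" by (auto simp: feasible_def)
  moreover have "closed ((\<lambda>p::('t, 'n) profile. p $ n) -` feasible_set S n)" for n
    by (intro closed_vimage continuous_intros compact_imp_closed compact_feasible_set)
  ultimately show ?thesis by auto
qed

end

section \<open>From summable expectations to convergence of almost every path\<close>

lemma AE_summable_if_nn_integral_le:
  fixes f :: "nat \<Rightarrow> 'w \<Rightarrow> real"
  assumes [measurable]: "\<And>k. f k \<in> borel_measurable M"
    and "\<And>k \<omega>. f k \<omega> \<ge> 0"
    and le: "\<And>k. (\<integral>\<^sup>+\<omega>. ennreal (f k \<omega>) \<partial>M) \<le> ennreal (d k)"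
    and d: "\<And>k. d k \<ge> 0" "summable d"
  shows "AE \<omega> in M. summable (\<lambda>k. f k \<omega>)"
proof -
  have "(\<integral>\<^sup>+\<omega>. (\<Sum>k. ennreal (f k \<omega>)) \<partial>M) = (\<Sum>k. \<integral>\<^sup>+\<omega>. ennreal (f k \<omega>) \<partial>M)"
    by (intro nn_integral_suminf) measurable
  also have "\<dots> \<le> (\<Sum>k. ennreal (d k))" by (intro suminf_le le) auto
  also have "\<dots> < \<infinity>" using suminf_ennreal_eq[OF d(1) summable_sums[OF d(2)]] by simp
  finally have "AE \<omega> in M. (\<Sum>k. ennreal (f k \<omega>)) \<noteq> \<infinity>"
    by (intro nn_integral_PInf_AE) auto
  then show ?thesis
    by eventually_elim (intro summable_suminf_not_top assms, simp)
qed

lemma convergent_if_summable_increments: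
  fixes x :: "nat \<Rightarrow> 'a::banach"
  assumes "summable (\<lambda>k. norm (x (Suc k) - x k))"
  shows "convergent x"
proof -
  have "(\<lambda>n. \<Sum>k<n. x (Suc k) - x k) \<longlonglongrightarrow> (\<Sum>k. x (Suc k) - x k)"
    using summable_norm_cancel[OF assms] by (rule summable_LIMSEQ)
  then have "(\<lambda>n. (x n - x 0) + x 0) \<longlonglongrightarrow> (\<Sum>k. x (Suc k) - x k) + x 0"
    by (intro tendsto_add tendsto_const) (simp add: sum_lessThan_telescope)
  then show ?thesis by (auto simp: convergent_def)
qed

theorem theorem3:
  fixes S :: "('t :: {finite, linorder}, 'n :: finite) da_problem"
    and p0 :: "('t, 'n) profile"
    and M :: "'w measure"
    and X :: "nat \<Rightarrow> 'w \<Rightarrow> ('t, 'n) profile"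
  assumes "CARD('n) \<ge> 2"
    and "valid_problem S"
    and "feasible S p0"
    and "off_ds_process S p0 M X"
  shows "\<exists>Q \<in> borel_measurable M.
           AE \<omega> in M. equilibrium S (Q \<omega>) \<and> (\<lambda>k. X k \<omega>) \<longlonglongrightarrow> Q \<omega>"
proof -
  interpret off_ds S using assms(1,2) by unfold_locales
  interpret prob_space M using assms(4) by (simp add: off_ds_process_def)
  interpret elementary_markov_chain M X "step S" p0
    using assms(4) by unfold_locales (auto simp: off_ds_process_def finite_step)
  have feas: "feasible S p" if "p \<in> set_pmf (marginal k)" for k p
    using that assms(3) by (induction k) (auto dest: feasible_step)
  obtain \<Phi> c where c: "c > 0" and \<Phi>: "\<And>p. feasible S p \<Longrightarrow> \<Phi> p \<ge> 0"
    "\<And>p. feasible S p \<Longrightarrow> measure_pmf.expectation (step S p) \<Phi> \<le> \<Phi> p - c * norm (drift p)"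
    by (rule lyapunov) (blast intro: that)
  obtain c' where c': "c' > 0"
    "\<And>p. feasible S p \<Longrightarrow> measure_pmf.expectation (step S p) (\<lambda>p'. norm (p' - p)) \<le> c' * norm (drift p)"
    using expectation_displacement_le by blast
  let ?E = "\<lambda>k. measure_pmf.expectation (marginal k)"
  note int = integrable_measure_pmf_finite[OF finite_marginal]
  define d where "d k = ?E k (\<lambda>p. norm (drift p))" for k
  have d0: "d k \<ge> 0" for k unfolding d_def by (intro integral_nonneg_AE) auto
  have dec: "?E (Suc k) \<Phi> \<le> ?E k \<Phi> - c * d k" for k
  proof -
    have "?E (Suc k) \<Phi> = ?E k (\<lambda>p. measure_pmf.expectation (step S p) \<Phi>)"
      by (simp add: pmf_expectation_bind[OF finite_marginal[of k] finite_step subset_refl]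
          integral_measure_pmf[OF finite_marginal])
    also have "\<dots> \<le> ?E k (\<lambda>p. \<Phi> p - c * norm (drift p))"
      by (intro expectation_mono_pmf finite_marginal \<Phi>(2) feas)
    also have "\<dots> = ?E k \<Phi> - c * d k" by (simp add: int d_def)
    finally show ?thesis .
  qed
  \<comment> \<open>Telescoping the Lyapunov decrease; nonnegativity at time \<open>n\<close> makes
    the partial sums bounded.\<close>
  have "c * (\<Sum>k<n. d k) \<le> ?E 0 \<Phi> - ?E n \<Phi>" for n
  proof (induction n)
    case (Suc n)
    then show ?case using dec[of n] by (simp add: distrib_left del: marginal.simps)
  qed simp
  moreover have "?E n \<Phi> \<ge> 0" for n
    by (intro integral_nonneg_AE) (auto simp: AE_measure_pmf_iff intro: \<Phi> feas)
  ultimately have "c * (\<Sum>k<n. d k) \<le> ?E 0 \<Phi>" for n by (smt (verit))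
  then have "(\<Sum>k<n. d k) \<le> ?E 0 \<Phi> / c" for n using c by (simp add: field_simps)
  then have d: "summable d" by (intro summableI_nonneg_bounded d0)
  have drift_measurable [measurable]: "drift \<in> borel_measurable borel"
    by (intro borel_measurable_continuous_onI continuous_on_drift)
  \<comment> \<open>Summable displacements make the path itself converge; the summable drifts below
    serve to identify the limit.\<close>
  have "AE \<omega> in M. summable (\<lambda>k. norm (X (Suc k) \<omega> - X k \<omega>))"
  proof (rule AE_summable_if_nn_integral_le)
    fix k
    have "?E k (\<lambda>p. measure_pmf.expectation (step S p) (\<lambda>p'. norm (p' - p))) \<le> ?E k (\<lambda>p. c' * norm (drift p))"
      by (intro expectation_mono_pmf finite_marginal c'(2) feas)
    then show "(\<integral>\<^sup>+\<omega>. ennreal (norm (X (Suc k) \<omega> - X k \<omega>)) \<partial>M) \<le> ennreal (c' * d k)"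
      using nn_integral_pair[of "\<lambda>p p'. norm (p' - p)" k] by (simp add: ennreal_leI d_def)
  qed (use c'(1) d0 d in \<open>auto intro: summable_mult\<close>)
  moreover have "AE \<omega> in M. summable (\<lambda>k. norm (drift (X k \<omega>)))"
  proof (rule AE_summable_if_nn_integral_le[OF _ _ _ d0 d])
    show "(\<integral>\<^sup>+\<omega>. ennreal (norm (drift (X k \<omega>))) \<partial>M) \<le> ennreal (d k)" for k
      using nn_integral_pair[of "\<lambda>p p'. norm (drift p)" k] by (simp add: d_def)
  qed auto
  moreover have "AE \<omega> in M. \<forall>k. X k \<omega> \<in> set_pmf (marginal k)"
    using AE_marginal by (simp add: AE_all_countable)
  ultimately have "AE \<omega> in M. equilibrium S (lim (\<lambda>k. X k \<omega>)) \<and> (\<lambda>k. X k \<omega>) \<longlonglongrightarrow> lim (\<lambda>k. X k \<omega>)"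
  proof eventually_elim
    case (elim \<omega>)
    let ?q = "lim (\<lambda>k. X k \<omega>)"
    have lim: "(\<lambda>k. X k \<omega>) \<longlonglongrightarrow> ?q"
      using convergent_if_summable_increments[OF elim(1)] by (simp add: convergent_LIMSEQ_iff)
    have "feasible S ?q"
      using closed_sequentially[OF closed_feasible _ lim] elim(3) feas by auto
    moreover have "drift ?q = 0"
    proof (rule LIMSEQ_unique)
      show "(\<lambda>k. drift (X k \<omega>)) \<longlonglongrightarrow> drift ?q"
        by (rule continuous_on_tendsto_compose[OF continuous_on_drift lim]) auto
      show "(\<lambda>k. drift (X k \<omega>)) \<longlonglongrightarrow> 0"
        using summable_LIMSEQ_zero[OF elim(2)] by (rule tendsto_norm_zero_cancel)
    qed
    ultimately show ?case using lim equilibrium_if_no_drift by blast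
  qed
  \<comment> \<open>The witness for \<open>Q\<close> is the pathwise limit; where the path diverges,
    a null set, \<open>lim\<close> has an unspecified value without loss of measurability.\<close>
  moreover have "(\<lambda>\<omega>. lim (\<lambda>k. X k \<omega>)) \<in> borel_measurable M"
    by (intro borel_measurable_lim_metric X_measurable)
  ultimately show ?thesis by (rule bexI)
qed

end
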